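(* Let $\mathbb{F}$ be a field of characteristic $0$, $m\ge 1$, $n=2m+1$, $c\in\mathbb{F}$. Let $S\subseteq\{1,\dots,n\}$ satisfy: $m+1\notin S$, and for each $i\in\{1,\dots,m\}$ at most one of $i$ and $i+m+1$ lies in $S$. Let $\vec a=(a_1,\dots,a_n)\in\mathbb{F}^n$. Consider the representations $\pi_{c,S}^{\vec a}$ of $sl(n+1,\mathbb{F})=sl(2m+2,\mathbb{F})$ restricted to the subalgebra $sp(2m+2,\mathbb{F})$. (i) If $c\notin-\mathbb{N}$, the restriction of $\pi_{c,\emptyset}^{\vec 0}$ to $sp(2m+2,\mathbb{F})$ is irreducible. If $c\in-\mathbb{N}$, then $\mathscr{A}$, as an $sp(2m+2,\mathbb{F})$-module via $\pi_{c,\emptyset}^{\vec 0}$, has a composition series of length $2$. (ii) If $S\ne\emptyset$ and $c\in\mathbb{F}\setminus\mathbb{Z}$, the restriction of $\pi_{c,S}^{\vec 0}$ to $sp(2m+2,\mathbb{F})$ is irreducible. (iii) Suppose all of the following hold: - $\vec a\neq\vec 0$ and $a_{m+1}=0$; - if $S\cap\{m+2,\dots,2m+1\}\ne\emptyset$, then $a_{i_0}\neq0$ for some $i_0$ with $m+1+i_0\in S$; - if $S\cap\{1,\dots,m+1\}\neq\emptyset$, then $a_{m+1+j_0}\neq 0$ for some $j_0\in S\cap\{1,\dots,m+1\}$. Then the restriction of $\pi_{c,S}^{\vec a}$ to $sp(2m+2,\mathbb{F})$ is irreducible for every $c\in\mathbb{F}$. (iv) For every such $S$ and every $c$, $\mathscr{A}$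 with the restricted representation $\pi_{c,S}^{\vec 0}$ is an infinite-dimensional weight $sp(2m+2,\mathbb{F})$-module with finite-dimensional weight subspaces. Weights are taken relative to the Cartan subalgebra $H=\operatorname{span}\{E_{i,i}-E_{m+1+i,m+1+i}: 1\le i\le m+1\}$.
   Context: Let $E_{r,s}$ denote the $(2m+2)\times(2m+2)$ matrix unit. The symplectic Lie algebra is realized as $$sp(2m+2,\mathbb{F})=\operatorname{span}\{E_{r,m+1+s}+E_{s,m+1+r},\ E_{m+1+r,s}+E_{m+1+s,r}: 1\le r\le s\le m+1\}+\operatorname{span}\{E_{i,j}-E_{m+1+j,m+1+i}: 1\le i,j\le m+1\}\subseteq sl(2m+2,\mathbb{F}).$$ $\mathbb{N}$ denotes the nonnegative integers. Let $\mathscr{A}=\mathbb{F}[x_1,\dots,x_n]$. For $\vec a\in\mathbb{F}^n$ put $\vec a\cdot\vec x=\sum_i a_ix_i$. Let $\mathscr{A}_{\vec a}=\{fe^{\vec a\cdot\vec x}: f\in\mathscr{A}\}$, where $e^{\vec a\cdot\vec x}$ is a formal symbol. The operators act on $\mathscr{A}_{\vec a}$ by - $x_i(fe^{\vec a\cdot \vec x})=(x_if)e^{\vec a\cdot\vec x}$, - $\partial_{x_i}(fe^{\vec a\cdot\vec x})=(\partial_{x_i}f+a_if)e^{\vec a\cdot\vec x}$. In particular $\mathscr{A}_{\vec 0}=\mathscr{A}$. Given $S\subseteq\{1,\dots,n\}$, define operators $X_r,P_r$ as follows: - $X_r=\partial_{x_r}$ and $P_r=-x_r$ if $r\in S$;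 - $X_r=x_r$ and $P_r=\partial_{x_r}$ if $r\notin S$. Put $D_S=\sum_{s=1}^n X_sP_s$ (products taken in the written order). The representation $\pi_{c,S}$ of $sl(n+1,\mathbb{F})$ is defined by the following formulas, for $i\ne j$ in $\{1,\dots,n\}$: - $\pi_{c,S}(E_{i,j})=X_iP_j$, - $\pi_{c,S}(E_{i,n+1})=X_i(D_S+c)$, - $\pi_{c,S}(E_{n+1,i})=-P_i$, - $\pi_{c,S}(E_{i,i}-E_{j,j})=X_iP_i-X_jP_j$, - $\pi_{c,S}(E_{n,n}-E_{n+1,n+1})=D_S+c+X_nP_n$. The representation $\pi_{c,S}$ acting on $\mathscr{A}_{\vec a}$ is denoted $\pi_{c,S}^{\vec a}$. *)

theory Defs
  imports Main "HOL-Library.Poly_Mapping"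
begin

text \<open>Polynomials in the variables x_1, ..., x_n over a field: elements of
  (nat =>0 nat) =>0 'a whose monomials only involve variables 1..n.
  The space A_a = A e^{a.x} is identified (as a vector space) with A; the formal
  factor e^{a.x} only changes the action of the derivations.\<close>

type_synonym 'a mpol = "(nat \<Rightarrow>\<^sub>0 nat) \<Rightarrow>\<^sub>0 'a"

definition polys :: "nat \<Rightarrow> ('a::zero) mpol set" where
  "polys n = {f. \<forall>\<alpha>\<in>Poly_Mapping.keys f. Poly_Mapping.keys \<alpha> \<subseteq> {1..n}}"

definition psmult :: "'a::semiring_0 \<Rightarrow> 'a mpol \<Rightarrow> 'a mpol" where
  "psmult c f = Poly_Mapping.map (\<lambda>v. c * v) f"

definition mulx :: "nat \<Rightarrow> ('a::comm_ring_1) mpol \<Rightarrow> 'a mpol" where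
  "mulx i f = Poly_Mapping.single (Poly_Mapping.single i 1) 1 * f"

definition pdx :: "nat \<Rightarrow> ('a::comm_ring_1) mpol \<Rightarrow> 'a mpol" where
  "pdx i f = (\<Sum>\<alpha>\<in>Poly_Mapping.keys f. Poly_Mapping.single (\<alpha> - Poly_Mapping.single i 1)
                              (of_nat (Poly_Mapping.lookup \<alpha> i) * Poly_Mapping.lookup f \<alpha>))"

text \<open>action of partial_{x_i} on A_a: (f e^{a.x}) |-> (d_i f + a_i f) e^{a.x}\<close>
definition dxa :: "(nat \<Rightarrow> 'a) \<Rightarrow> nat \<Rightarrow> ('a::comm_ring_1) mpol \<Rightarrow> 'a mpol" where
  "dxa a i f = pdx i f + psmult (a i) f"

definition Xop :: "nat set \<Rightarrow> (nat \<Rightarrow> 'a) \<Rightarrow> nat \<Rightarrow> ('a::comm_ring_1) mpol \<Rightarrow> 'a mpol" where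
  "Xop S a r f = (if r \<in> S then dxa a r f else mulx r f)"

definition Pop :: "nat set \<Rightarrow> (nat \<Rightarrow> 'a) \<Rightarrow> nat \<Rightarrow> ('a::comm_ring_1) mpol \<Rightarrow> 'a mpol" where
  "Pop S a r f = (if r \<in> S then - mulx r f else dxa a r f)"

definition Dop :: "nat \<Rightarrow> nat set \<Rightarrow> (nat \<Rightarrow> 'a) \<Rightarrow> ('a::comm_ring_1) mpol \<Rightarrow> 'a mpol" where
  "Dop n S a f = (\<Sum>s=1..n. Xop S a s (Pop S a s f))"

text \<open>pi_{c,S}^a on the matrix unit E_{i,j}, i \<noteq> j, 1 \<le> i,j \<le> n+1.\<close>
definition piE :: "nat \<Rightarrow> 'a \<Rightarrow> nat set \<Rightarrow> (nat \<Rightarrow> 'a) \<Rightarrow> nat \<Rightarrow> nat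
                    \<Rightarrow> ('a::comm_ring_1) mpol \<Rightarrow> 'a mpol" where
  "piE n c S a i j f =
     (if j = n + 1 then Xop S a i (Dop n S a f + psmult c f)
      else if i = n + 1 then - Pop S a j f
      else Xop S a i (Pop S a j f))"

text \<open>pi_{c,S}^a on E_{i,i} - E_{n+1,n+1}, 1 \<le> i \<le> n; by linearity this equals
  pi(E_ii - E_nn) + pi(E_nn - E_{n+1,n+1}) = X_i P_i + D_S + c.\<close>
definition piH :: "nat \<Rightarrow> 'a \<Rightarrow> nat set \<Rightarrow> (nat \<Rightarrow> 'a) \<Rightarrow> nat
                    \<Rightarrow> ('a::comm_ring_1) mpol \<Rightarrow> 'a mpol" where
  "piH n c S a i f = Xop S a i (Pop S a i f) + Dop n S a f + psmult c f"

text \<open>Matrices of size (n+1)x(n+1) are functions nat => nat => 'a (entries at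
  indices 1..n+1).  For a trace-zero matrix M one has
  M = sum_{i \<noteq> j} M_ij E_ij + sum_{i=1}^n M_ii (E_ii - E_{n+1,n+1}),
  so the linear map pi_{c,S}^a is given by:\<close>
definition piM :: "nat \<Rightarrow> 'a \<Rightarrow> nat set \<Rightarrow> (nat \<Rightarrow> 'a) \<Rightarrow> (nat \<Rightarrow> nat \<Rightarrow> 'a)
                    \<Rightarrow> ('a::comm_ring_1) mpol \<Rightarrow> 'a mpol" where
  "piM n c S a M f =
     (\<Sum>i=1..n+1. \<Sum>j\<in>{1..n+1}-{i}. psmult (M i j) (piE n c S a i j f))
     + (\<Sum>i=1..n. psmult (M i i) (piH n c S a i f))"

definition matE :: "nat \<Rightarrow> nat \<Rightarrow> nat \<Rightarrow> nat \<Rightarrow> 'a::zero_neq_one" where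
  "matE r s = (\<lambda>i j. if i = r \<and> j = s then 1 else 0)"

definition sp :: "nat \<Rightarrow> (nat \<Rightarrow> nat \<Rightarrow> 'a::comm_ring_1) set" where
  "sp m = {M. \<exists>\<alpha> \<beta> \<gamma>. M = (\<lambda>i j.
      (\<Sum>r=1..m+1. \<Sum>s=r..m+1. \<alpha> r s * (matE r (m+1+s) i j + matE s (m+1+r) i j))
    + (\<Sum>r=1..m+1. \<Sum>s=r..m+1. \<beta> r s * (matE (m+1+r) s i j + matE (m+1+s) r i j))
    + (\<Sum>r=1..m+1. \<Sum>s=1..m+1. \<gamma> r s * (matE r s i j - matE (m+1+s) (m+1+r) i j)))}"

definition lin_subspace :: "('a::comm_ring_1) mpol set \<Rightarrow> bool" where
  "lin_subspace W \<longleftrightarrow> 0 \<in> W \<and> (\<forall>x\<in>W. \<forall>y\<in>W. x + y \<in> W) \<and> (\<forall>c x. x \<in> W \<longrightarrow> psmult c x \<in> W)"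

definition lin_span :: "('a::comm_ring_1) mpol set \<Rightarrow> 'a mpol set" where
  "lin_span B = {\<Sum>b\<in>B'. psmult (k b) b | B' k. finite B' \<and> B' \<subseteq> B}"

definition fin_dim :: "('a::comm_ring_1) mpol set \<Rightarrow> bool" where
  "fin_dim W \<longleftrightarrow> (\<exists>B. finite B \<and> W \<subseteq> lin_span B)"

definition submodule :: "('l \<Rightarrow> 'a mpol \<Rightarrow> 'a mpol) \<Rightarrow> 'l set \<Rightarrow> 'a mpol set
                          \<Rightarrow> ('a::comm_ring_1) mpol set \<Rightarrow> bool" where
  "submodule rho L V W \<longleftrightarrow> W \<subseteq> V \<and> lin_subspace W \<and> (\<forall>x\<in>L. \<forall>w\<in>W. rho x w \<in> W)"

definition irreducible_mod :: "('l \<Rightarrow> 'a mpol \<Rightarrow> 'a mpol) \<Rightarrow> 'l set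
                          \<Rightarrow> ('a::comm_ring_1) mpol set \<Rightarrow> bool" where
  "irreducible_mod rho L V \<longleftrightarrow> V \<noteq> {0} \<and>
     (\<forall>W. submodule rho L V W \<longrightarrow> W = {0} \<or> W = V)"

text \<open>Composition series 0 < W < V of length 2: both factors W and V/W simple
  (submodules of V/W correspond to submodules of V containing W).\<close>
definition comp_series_length2 :: "('l \<Rightarrow> 'a mpol \<Rightarrow> 'a mpol) \<Rightarrow> 'l set
                          \<Rightarrow> ('a::comm_ring_1) mpol set \<Rightarrow> bool" where
  "comp_series_length2 rho L V \<longleftrightarrow> (\<exists>W. submodule rho L V W \<and> W \<noteq> {0} \<and> W \<noteq> V \<and>
     (\<forall>U. submodule rho L V U \<longrightarrow> U \<subseteq> W \<longrightarrow> U = {0} \<or> U = W) \<and>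
     (\<forall>U. submodule rho L V U \<longrightarrow> W \<subseteq> U \<longrightarrow> U = W \<or> U = V))"

text \<open>Cartan element h_i = E_{i,i} - E_{m+1+i,m+1+i}; weights are functionals on
  H = span{h_1..h_{m+1}}, given by their values mu i on h_i.\<close>
definition cartan :: "nat \<Rightarrow> nat \<Rightarrow> nat \<Rightarrow> nat \<Rightarrow> 'a::comm_ring_1" where
  "cartan m i = (\<lambda>r s. matE i i r s - matE (m+1+i) (m+1+i) r s)"

definition weight_space :: "nat \<Rightarrow> ((nat \<Rightarrow> nat \<Rightarrow> 'a) \<Rightarrow> 'a mpol \<Rightarrow> 'a mpol)
                              \<Rightarrow> ('a::comm_ring_1) mpol set \<Rightarrow> (nat \<Rightarrow> 'a) \<Rightarrow> 'a mpol set" where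
  "weight_space m rho V \<mu> = {v\<in>V. \<forall>i\<in>{1..m+1}. rho (cartan m i) v = psmult (\<mu> i) v}"

text \<open>Weight module: V is the (necessarily direct) sum of its weight spaces.\<close>
definition weight_module :: "nat \<Rightarrow> ((nat \<Rightarrow> nat \<Rightarrow> 'a) \<Rightarrow> 'a mpol \<Rightarrow> 'a mpol)
                              \<Rightarrow> ('a::comm_ring_1) mpol set \<Rightarrow> bool" where
  "weight_module m rho V \<longleftrightarrow>
     (\<forall>v\<in>V. \<exists>\<Lambda> w. finite \<Lambda> \<and> (\<forall>\<mu>\<in>\<Lambda>. w \<mu> \<in> weight_space m rho V \<mu>) \<and> v = (\<Sum>\<mu>\<in>\<Lambda>. w \<mu>))"

end

(* Write X_r, P_r for the operators of the paper, z = m + 1, and r' for the index paired with r by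
   the symplectic form.  The algebra sp is spanned by the matrices gen m u v, and these act (up to
   scalars) by P_z, X_z (D + c), X_z P_z + D + c, the lowering operators P_u -+ X_u' P_z, the
   raising operators X_u (D + c) +- X_z P_u', and the quadratic operators X_u P_v -+ X_v' P_u'.
   In every case a nonzero submodule contains a nonzero element killed by P_z.

   For S empty and a = 0, an element of minimal degree is constant, and the raising operators
   produce the monomials of degree k + 1 from those of degree k as long as c + k is nonzero.  If
   c = -k, the polynomials of degree at most k form a submodule; modulo it, every larger submodule
   contains the lowest weight vector x_1^(k+1), from which sp(2m) and the raising operators reach
   everything.

   For a = 0 and c not an integer, the elements of a submodule that are joint eigenvectors of D and
   X_z P_z are closed under all X_r and P_r, so simplicity of the Weyl algebra module applies.

   In the twisted case choose v outside S with a_v nonzero.  Since P_v is invertible on polynomials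
   of bounded degree, the quadratic operators lower any element to a constant and
   raise it to all polynomials without x_z, and a raising operator adds x_z. *)

theory Submission
  imports Defs "HOL.Modules"
begin

section \<open>Polynomials\<close>

text \<open>The difficulty is that sp offers few operators in a single variable: \<open>P u\<close>
  with u other than z comes bundled with \<open>X (d u)\<close> after \<open>P z\<close>, and
  \<open>X u\<close> after D + c with \<open>X z\<close> after \<open>P (d u)\<close>. The
  corrections must be made to vanish or to be known already. On the kernel of \<open>P z\<close> the
  lowering operators are plain \<open>P u\<close> and the generator attached to z is D + c; raising
  a monomial of degree k produces a correction of degree k. For c = -k the factor D + c kills degree
  k, so degree k + 1 cannot be reached from below. A submodule above the polynomials of degree at
  most k is studied through its own elements: truncation replaces the quotient, and a weighting of
  the variables that makes the chosen operators strictly decreasing isolates x_1^(k+1). A nonzero a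
  destroys the grading, so the twisted case uses filtrations. For nonempty S the conditions on a
  produce v: they give a nonzero entry at the partner of an index of S, and the partner lies outside
  S because S meets each pair at most once.\<close>

abbreviation coef :: "('b \<Rightarrow>\<^sub>0 'c::zero) \<Rightarrow> 'b \<Rightarrow> 'c" where
  "coef \<equiv> Poly_Mapping.lookup"

abbreviation unit_exp :: "nat \<Rightarrow> (nat \<Rightarrow>\<^sub>0 nat)" ("\<e>") where
  "\<e> i \<equiv> Poly_Mapping.single i (Suc 0)"

abbreviation mon :: "(nat \<Rightarrow>\<^sub>0 nat) \<Rightarrow> ('a::comm_ring_1) mpol" where
  "mon \<alpha> \<equiv> Poly_Mapping.single \<alpha> 1"

notation psmult (infixr "\<cdot>" 75)

lemma coef_psmult [simp]: "coef (k \<cdot> f) \<alpha> = k * coef f \<alpha>"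
  by (simp add: psmult_def Poly_Mapping.map.rep_eq when_def)

interpretation mpol: module "psmult :: 'a::comm_ring_1 \<Rightarrow> _"
  by unfold_locales (auto intro!: poly_mapping_eqI simp: lookup_add algebra_simps)

lemma lin_subspace_iff: "lin_subspace W \<longleftrightarrow> mpol.subspace W"
  by (auto simp: lin_subspace_def mpol.subspace_def)

lemma lin_span_eq: "lin_span B = mpol.span B"
  by (auto simp: lin_span_def mpol.span_explicit)

lemma fin_dim_iff: "fin_dim W \<longleftrightarrow> (\<exists>B. finite B \<and> W \<subseteq> mpol.span B)"
  by (simp add: fin_dim_def lin_span_eq)

lemma unit_exp_le: "coef \<alpha> i \<noteq> 0 \<Longrightarrow> \<alpha> - \<e> i + \<e> i = \<alpha>"
  by (auto intro!: poly_mapping_eqI simp: lookup_add lookup_minus lookup_single when_def)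

lemma coef_sum_single:
  "finite A \<Longrightarrow> coef (\<Sum>\<alpha>\<in>A. Poly_Mapping.single \<alpha> (u \<alpha>)) \<beta> = (if \<beta> \<in> A then u \<beta> else 0)"
  by (simp add: lookup_sum lookup_single when_def)

lemma mpol_expand: "f = (\<Sum>\<alpha>\<in>Poly_Mapping.keys f. coef f \<alpha> \<cdot> mon \<alpha>)"
  by (rule poly_mapping_eqI)
    (simp add: lookup_sum lookup_single when_def in_keys_iff if_distrib cong: if_cong)

lemma coef_mulx: "coef (mulx i f) \<alpha> = (if coef \<alpha> i = 0 then 0 else coef f (\<alpha> - \<e> i))"
proof -
  have *: "\<alpha> = \<e> i + q \<longleftrightarrow> coef \<alpha> i \<noteq> 0 \<and> q = \<alpha> - \<e> i" for q
    using unit_exp_le[of \<alpha> i] by (auto simp: lookup_add add.commute)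
  have "coef (mulx i f) \<alpha> = (\<Sum>l. (1 when \<e> i = l) * (\<Sum>q. coef f q when \<alpha> = l + q))"
    by (simp add: mulx_def lookup_mult lookup_single)
  also have "\<dots> = (\<Sum>q. coef f q when \<alpha> = \<e> i + q)"
    by (simp add: when_mult)
  also have "\<dots> = (if coef \<alpha> i = 0 then 0 else coef f (\<alpha> - \<e> i))"
    unfolding * by simp
  finally show ?thesis .
qed

lemma coef_pdx: "coef (pdx i f) \<alpha> = of_nat (coef \<alpha> i + 1) * coef f (\<alpha> + \<e> i)"
proof -
  have *: "coef (Poly_Mapping.single (\<beta> - \<e> i) (of_nat (coef \<beta> i) * coef f \<beta>)) \<alpha>
      = (if \<beta> = \<alpha> + \<e> i then of_nat (coef \<alpha> i + 1) * coef f \<beta> else 0)" for \<beta>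
  proof (cases "coef \<beta> i = 0")
    case False
    hence "\<beta> = \<alpha> + \<e> i \<longleftrightarrow> \<beta> - \<e> i = \<alpha>"
      using unit_exp_le[of \<beta> i] by auto
    thus ?thesis using False by (auto simp: lookup_single lookup_add lookup_minus when_def simp del: of_nat_Suc simp flip: One_nat_def)
  qed (auto simp: lookup_add)
  show ?thesis
    unfolding pdx_def lookup_sum One_nat_def * by (auto simp: in_keys_iff)
qed

lemma coef_dxa: "coef (dxa a i f) \<alpha> = of_nat (coef \<alpha> i + 1) * coef f (\<alpha> + \<e> i) + a i * coef f \<alpha>"
  by (simp add: dxa_def lookup_add coef_pdx)

lemmas coef_simps = coef_mulx coef_pdx coef_dxa lookup_add lookup_minus

lemma mulx_add: "mulx i (f + g) = mulx i f + mulx i g"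
  and mulx_psmult: "mulx i (k \<cdot> f) = k \<cdot> mulx i f"
  and pdx_add: "pdx i (f + g) = pdx i f + pdx i g"
  and pdx_psmult: "pdx i (k \<cdot> f) = k \<cdot> pdx i f"
  by (auto intro!: poly_mapping_eqI simp: coef_simps algebra_simps)

lemma mulx_commute: "mulx i (mulx j f) = mulx j (mulx i f)"
  by (simp add: mulx_def mult.left_commute)

lemma pdx_commute: "pdx i (pdx j f) = pdx j (pdx i f)"
  by (rule poly_mapping_eqI) (auto simp: coef_simps lookup_single when_def add.commute add.left_commute)

lemma pdx_mulx: "pdx i (mulx j f) = mulx j (pdx i f) + (if i = j then f else 0)"
proof (rule poly_mapping_eqI)
  fix \<alpha>
  show "coef (pdx i (mulx j f)) \<alpha> = coef (mulx j (pdx i f) + (if i = j then f else 0)) \<alpha>"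
  proof (cases "i = j")
    case True
    thus ?thesis
      by (cases "coef \<alpha> j") (use unit_exp_le[of \<alpha> j] in \<open>auto simp: coef_simps lookup_single algebra_simps\<close>)
  next
    case False
    have "\<alpha> + \<e> i - \<e> j = \<alpha> - \<e> j + \<e> i" if "coef \<alpha> j \<noteq> 0"
      using that False
      by (intro poly_mapping_eqI) (auto simp: lookup_add lookup_minus lookup_single when_def)
    thus ?thesis using False
      by (auto simp: coef_simps lookup_single)
  qed
qed

lemma mulx_mon: "mulx i (mon \<alpha>) = mon (\<alpha> + \<e> i)"
  by (simp add: mulx_def mult_single add.commute)

lemma pdx_mon: "pdx i (mon \<alpha>) = of_nat (coef \<alpha> i) \<cdot> mon (\<alpha> - \<e> i)"
  by (simp add: pdx_def psmult_def)

section \<open>Operators and generators of the symplectic algebra\<close>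

abbreviation lin_op :: "(('a::comm_ring_1) mpol \<Rightarrow> 'a mpol) \<Rightarrow> bool" where
  "lin_op \<equiv> module_hom psmult psmult"

lemma lin_opI:
  assumes "\<And>f g. T (f + g) = T f + T g" and "\<And>k f. T (k \<cdot> f) = k \<cdot> T f"
  shows "lin_op T"
  using assms by unfold_locales auto

lemma lin_mulx: "lin_op (mulx i)" and lin_pdx: "lin_op (pdx i)" and lin_dxa: "lin_op (dxa a i)"
  by (auto intro!: lin_opI simp: mulx_add mulx_psmult pdx_add pdx_psmult dxa_def
      mpol.scale_right_distrib mult.commute)

lemma lin_Xop: "lin_op (Xop S a i)"
  unfolding Xop_def by (cases "i \<in> S") (simp_all add: lin_mulx lin_dxa)

lemma lin_Pop: "lin_op (Pop S a i)"
  unfolding Pop_def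
  by (cases "i \<in> S") (auto intro!: lin_opI simp: mulx_add mulx_psmult lin_dxa)

lemma lin_Dop: "lin_op (Dop n S a)"
  unfolding Dop_def
  by (intro lin_opI)
    (simp_all add: module_hom.add[OF lin_Xop] module_hom.add[OF lin_Pop] sum.distrib
      module_hom.scale[OF lin_Xop] module_hom.scale[OF lin_Pop] mpol.scale_sum_right)

lemmas op_add = lin_Xop[THEN module_hom.add] lin_Pop[THEN module_hom.add]
  lin_Dop[THEN module_hom.add] mulx_add pdx_add lin_dxa[THEN module_hom.add]
lemmas op_scale = lin_Xop[THEN module_hom.scale] lin_Pop[THEN module_hom.scale]
  lin_Dop[THEN module_hom.scale] mulx_psmult pdx_psmult lin_dxa[THEN module_hom.scale]
lemmas op_zero [simp] = lin_Xop[THEN module_hom.zero] lin_Pop[THEN module_hom.zero]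
  lin_Dop[THEN module_hom.zero] lin_mulx[THEN module_hom.zero] lin_pdx[THEN module_hom.zero]
  lin_dxa[THEN module_hom.zero]
lemmas op_neg = lin_Xop[THEN module_hom.neg] lin_Pop[THEN module_hom.neg]
  lin_Dop[THEN module_hom.neg] lin_mulx[THEN module_hom.neg] lin_pdx[THEN module_hom.neg]
  lin_dxa[THEN module_hom.neg]
lemmas op_diff = lin_Xop[THEN module_hom.diff] lin_Pop[THEN module_hom.diff]
  lin_Dop[THEN module_hom.diff] lin_mulx[THEN module_hom.diff] lin_pdx[THEN module_hom.diff]
  lin_dxa[THEN module_hom.diff]

lemma dxa_mulx: "dxa a i (mulx j f) = mulx j (dxa a i f) + (if i = j then f else 0)"
  by (simp add: dxa_def pdx_mulx mulx_add mulx_psmult)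

lemma dxa_commute: "dxa a i (dxa a j f) = dxa a j (dxa a i f)"
  by (simp add: dxa_def pdx_add pdx_psmult mpol.scale_right_distrib pdx_commute[of i j]
      mult.commute add_ac)

text \<open>Exchanging (x, d) for (d, -x) at the indices in S and shifting d by a constant are
  automorphisms of the Weyl algebra, so the canonical relations hold for every S and a.\<close>

lemma Pop_Xop: "Pop S a u (Xop S a v f) = Xop S a v (Pop S a u f) + (if u = v then f else 0)"
  by (auto simp: Pop_def Xop_def dxa_mulx op_neg mulx_commute[of u v] dxa_commute[of a u v])

lemma Xop_commute: "Xop S a u (Xop S a v f) = Xop S a v (Xop S a u f)"
  by (auto simp: Xop_def dxa_mulx mulx_commute[of u v] dxa_commute[of a u v])

lemma Pop_commute: "Pop S a u (Pop S a v f) = Pop S a v (Pop S a u f)"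
  by (auto simp: Pop_def dxa_mulx op_neg mulx_commute[of u v] dxa_commute[of a u v])

text \<open>\<open>polys\<close>, \<open>zfree\<close>, \<open>zbounded\<close> and
  \<open>low_polys\<close> are all cut out by conditions on exponents, so their linearity is this
  one fact.\<close>

lemma keys_subset_subspace: "mpol.subspace {f. Poly_Mapping.keys f \<subseteq> K}"
  unfolding mpol.subspace_def
proof (intro conjI ballI allI)
  fix f g :: "'a mpol" assume "f \<in> {f. Poly_Mapping.keys f \<subseteq> K}" "g \<in> {f. Poly_Mapping.keys f \<subseteq> K}"
  thus "f + g \<in> {f. Poly_Mapping.keys f \<subseteq> K}" using keys_add[of f g] by blast
next
  fix t and f :: "'a mpol" assume f: "f \<in> {f. Poly_Mapping.keys f \<subseteq> K}"
  have "Poly_Mapping.keys (t \<cdot> f) \<subseteq> Poly_Mapping.keys f" by (auto simp: in_keys_iff)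
  thus "t \<cdot> f \<in> {f. Poly_Mapping.keys f \<subseteq> K}" using f by blast
qed simp

lemma polys_eq_keys: "polys n = {f. Poly_Mapping.keys f \<subseteq> {\<alpha>. Poly_Mapping.keys \<alpha> \<subseteq> {1..n}}}"
  unfolding polys_def by blast

lemma polys_subspace: "mpol.subspace (polys n)"
  unfolding polys_eq_keys by (rule keys_subset_subspace)

lemma polys_iff:
  "f \<in> polys n \<longleftrightarrow> (\<forall>\<alpha> j. coef f \<alpha> \<noteq> 0 \<longrightarrow> coef \<alpha> j \<noteq> 0 \<longrightarrow> j \<in> {1..n})"
  unfolding polys_def subset_iff Ball_def mem_Collect_eq in_keys_iff by blast

lemma mon_in_polys [simp]: "mon \<alpha> \<in> polys n \<longleftrightarrow> Poly_Mapping.keys \<alpha> \<subseteq> {1..n}" for \<alpha>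
  by (simp add: polys_def)

lemma mulx_polys:
  assumes f: "f \<in> polys n" and i: "i \<in> {1..n}"
  shows "mulx i f \<in> polys n"
  unfolding polys_iff
proof (intro allI impI)
  fix \<alpha> j assume "coef (mulx i f) \<alpha> \<noteq> 0" and j: "coef \<alpha> j \<noteq> 0"
  hence "coef f (\<alpha> - \<e> i) \<noteq> 0" by (simp add: coef_mulx split: if_splits)
  moreover have "j = i \<or> coef (\<alpha> - \<e> i) j \<noteq> 0"
    using j by (simp add: lookup_minus lookup_single when_def)
  ultimately show "j \<in> {1..n}" using f i unfolding polys_iff by blast
qed

lemma pdx_polys:
  assumes f: "f \<in> polys n"
  shows "pdx i f \<in> polys n"
  unfolding polys_iff
proof (intro allI impI)
  fix \<alpha> j assume "coef (pdx i f) \<alpha> \<noteq> 0" and j: "coef \<alpha> j \<noteq> 0"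
  hence "coef f (\<alpha> + \<e> i) \<noteq> 0" by (auto simp: coef_pdx)
  moreover have "coef (\<alpha> + \<e> i) j \<noteq> 0" using j by (simp add: lookup_add)
  ultimately show "j \<in> {1..n}" using f unfolding polys_iff by blast
qed

lemma dxa_polys: "f \<in> polys n \<Longrightarrow> dxa a i f \<in> polys n"
  unfolding dxa_def
  by (intro mpol.subspace_add[OF polys_subspace] mpol.subspace_scale[OF polys_subspace] pdx_polys)

lemma Xop_polys: "f \<in> polys n \<Longrightarrow> i \<in> {1..n} \<Longrightarrow> Xop S a i f \<in> polys n"
  by (simp add: Xop_def mulx_polys dxa_polys)

lemma Pop_polys: "f \<in> polys n \<Longrightarrow> i \<in> {1..n} \<Longrightarrow> Pop S a i f \<in> polys n"
  by (simp add: Pop_def mulx_polys dxa_polys mpol.subspace_neg[OF polys_subspace])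

lemma Dop_polys: "f \<in> polys n \<Longrightarrow> Dop n S a f \<in> polys n"
  unfolding Dop_def by (intro mpol.subspace_sum[OF polys_subspace] Xop_polys Pop_polys) auto

section \<open>Generators of the symplectic algebra\<close>

definition dual :: "nat \<Rightarrow> nat \<Rightarrow> nat" where
  "dual m i = (if i \<le> m + 1 then i + m + 1 else i - (m + 1))"

definition eps :: "nat \<Rightarrow> nat \<Rightarrow> 'a::comm_ring_1" where
  "eps m i = (if i \<le> m + 1 then 1 else - 1)"

text \<open>A matrix unit minus its adjoint for the symplectic form covers all three spanning
  families at once. If u = \<open>dual m v\<close>, the two terms add up to twice a matrix unit. The
  index m + 1 is paired with n + 1, which carries no variable; this singles out z.\<close>

definition gen :: "nat \<Rightarrow> nat \<Rightarrow> nat \<Rightarrow> nat \<Rightarrow> nat \<Rightarrow> 'a::comm_ring_1" where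
  "gen m u v = (\<lambda>i j. matE u v i j - (eps m u * eps m v) * matE (dual m v) (dual m u) i j)"

lemma sum2_delta:
  fixes k :: "'a::comm_ring_1"
  assumes "finite A" "finite (B u)" "u \<in> A" "v \<in> B u"
  shows "(\<Sum>r\<in>A. \<Sum>s\<in>B r. (if r = u \<and> s = v then k else 0) * F r s) = k * F u v"
proof -
  have "(\<Sum>r\<in>A. \<Sum>s\<in>B r. (if r = u \<and> s = v then k else 0) * F r s)
     = (\<Sum>r\<in>A. if r = u then (\<Sum>s\<in>B r. if s = v then k * F r s else 0) else 0)"
    by (intro sum.cong refl) (auto intro!: sum.cong sum.neutral)
  also have "\<dots> = k * F u v"
    using assms by simp
  finally show ?thesis .
qed

lemma gen_in_sp:
  assumes u: "u \<in> {1..2*m+2}" and v: "v \<in> {1..2*m+2}"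
  shows "(gen m u v :: nat \<Rightarrow> nat \<Rightarrow> 'a::comm_ring_1) \<in> sp m"
proof -
  let ?\<delta> = "\<lambda>u v (k::'a) r s. if r = u \<and> s = v then k else 0"
  let ?z = "\<lambda>_ _. 0 :: 'a"
  consider (ll) "u \<le> m + 1" "v \<le> m + 1" | (lg) "u \<le> m + 1" "v > m + 1"
    | (gl) "u > m + 1" "v \<le> m + 1" | (gg) "u > m + 1" "v > m + 1" by linarith
  thus ?thesis
  proof cases
    case ll
    show ?thesis unfolding sp_def mem_Collect_eq
      apply (rule exI[of _ ?z], rule exI[of _ ?z], rule exI[of _ "?\<delta> u v 1"])
      apply (subst sum2_delta)
      using ll u v by (auto simp: gen_def eps_def dual_def fun_eq_iff add_ac)
  next
    case lg
    hence w: "v = m + 1 + (v - (m + 1))" "v - (m + 1) \<ge> 1" "v - (m + 1) \<le> m + 1"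
      using v by auto
    then obtain w where w: "v = m + 1 + w" "w \<ge> 1" "w \<le> m + 1" by blast
    \<comment> \<open>The spanning family runs over r \<le> s and is symmetric in the two indices,
      hence min and max.\<close>
    show ?thesis unfolding sp_def mem_Collect_eq
      apply (rule exI[of _ "?\<delta> (min u w) (max u w) 1"], rule exI[of _ ?z], rule exI[of _ ?z])
      apply (subst sum2_delta)
      using lg u w by (auto simp: gen_def eps_def dual_def fun_eq_iff add_ac min_def max_def)
  next
    case gl
    hence w: "u = m + 1 + (u - (m + 1))" "u - (m + 1) \<ge> 1" "u - (m + 1) \<le> m + 1"
      using u by auto
    then obtain w where w: "u = m + 1 + w" "w \<ge> 1" "w \<le> m + 1" by blast
    show ?thesis unfolding sp_def mem_Collect_eq
      apply (rule exI[of _ ?z], rule exI[of _ "?\<delta> (min v w) (max v w) 1"], rule exI[of _ ?z])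
      apply (subst sum2_delta)
      using gl v w by (auto simp: gen_def eps_def dual_def fun_eq_iff add_ac min_def max_def)
  next
    case gg
    hence "u = m + 1 + (u - (m + 1))" "u - (m + 1) \<ge> 1" "u - (m + 1) \<le> m + 1"
      "v = m + 1 + (v - (m + 1))" "v - (m + 1) \<ge> 1" "v - (m + 1) \<le> m + 1"
      using u v by auto
    then obtain p q where w: "u = m + 1 + p" "p \<ge> 1" "p \<le> m + 1" "v = m + 1 + q" "q \<ge> 1" "q \<le> m + 1"
      by blast
    \<comment> \<open>The family carries its plus sign on the upper left block, so a unit in the
      lower right block needs coefficient -1 and swapped indices.\<close>
    show ?thesis unfolding sp_def mem_Collect_eq
      apply (rule exI[of _ ?z], rule exI[of _ ?z], rule exI[of _ "?\<delta> q p (-1)"])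
      apply (subst sum2_delta)
      using gg w by (auto simp: gen_def eps_def dual_def fun_eq_iff add_ac)
  qed
qed

lemma piM_diff:
  "piM n c S a (\<lambda>i j. A i j - k * B i j) f = piM n c S a A f - k \<cdot> piM n c S a B f"
  by (simp add: piM_def mpol.scale_left_diff_distrib sum_subtractf mpol.scale_right_distrib
      mpol.scale_sum_right del: sum.cl_ivl_Suc)

lemma psmult_two: "2 \<cdot> f = f + f" for f :: "'a::comm_ring_1 mpol"
  by (metis mpol.scale_left_distrib mpol.scale_one one_add_one)

text \<open>A diagonal unit has nonzero trace, so its value is only a convention of the formula: u
  \<le> n counts as E_uu - E_{n+1,n+1}, and u = n + 1 as 0. On trace-free combinations such as
  \<open>gen\<close> these conventions cancel.\<close>

lemma piM_matE:
  assumes "u \<in> {1..n+1}" "v \<in> {1..n+1}"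
  shows "piM n c S a (matE u v) f
    = (if u \<noteq> v then piE n c S a u v f else if u \<le> n then piH n c S a u f else 0)"
proof -
  have 1: "(\<Sum>j\<in>{1..n+1}-{i}. matE u v i j \<cdot> piE n c S a i j f)
      = (if i = u then if u \<noteq> v then piE n c S a u v f else 0 else 0)" for i
  proof -
    have "(\<Sum>j\<in>{1..n+1}-{i}. matE u v i j \<cdot> piE n c S a i j f)
      = (\<Sum>j\<in>{1..n+1}-{i}. if j = v then if i = u then piE n c S a i j f else 0 else 0)"
      by (intro sum.cong) (auto simp: matE_def)
    also have "\<dots> = (if i = u then if u \<noteq> v then piE n c S a u v f else 0 else 0)"
      using assms by (subst sum.delta) auto
    finally show ?thesis .
  qed
  have 2: "(\<Sum>i=1..n. matE u v i i \<cdot> piH n c S a i f)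
      = (if u = v \<and> u \<le> n then piH n c S a u f else 0)"
  proof -
    have "(\<Sum>i=1..n. matE u v i i \<cdot> piH n c S a i f)
      = (\<Sum>i=1..n. if i = u then if u = v then piH n c S a i f else 0 else 0)"
      by (intro sum.cong) (auto simp: matE_def)
    also have "\<dots> = (if u = v \<and> u \<le> n then piH n c S a u f else 0)"
      using assms by (subst sum.delta) auto
    finally show ?thesis .
  qed
  show ?thesis
    unfolding piM_def 1 2 using assms by (subst sum.delta) auto
qed

lemma piM_gen:
  "piM n c S a (gen m u v) f = piM n c S a (matE u v) f
     - (eps m u * eps m v) \<cdot> piM n c S a (matE (dual m v) (dual m u)) f"
  unfolding gen_def by (rule piM_diff)

section \<open>Operators that preserve an sp-submodule\<close>

locale sp_submodule =
  fixes m n :: nat and c :: "'a::field_char_0" and S :: "nat set" and a :: "nat \<Rightarrow> 'a"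
    and W :: "'a mpol set"
  assumes m: "m \<ge> 1" and n: "n = 2 * m + 1" and zS: "m + 1 \<notin> S" and az: "a (m + 1) = 0"
    and sub: "submodule (piM n c S a) (sp m) (polys n) W"
begin

abbreviation X where "X \<equiv> Xop S a"
abbreviation P where "P \<equiv> Pop S a"
abbreviation D where "D \<equiv> Dop n S a"
abbreviation z where "z \<equiv> m + 1"
abbreviation I where "I \<equiv> {1..n} - {z}"
abbreviation \<epsilon> :: "nat \<Rightarrow> 'a" where "\<epsilon> \<equiv> eps m"
abbreviation d where "d \<equiv> dual m"

lemma W_polys: "f \<in> W \<Longrightarrow> f \<in> polys n"
  using sub by (auto simp: submodule_def)

lemma W_subspace: "mpol.subspace W"
  using sub by (simp add: submodule_def lin_subspace_iff)

lemmas W_add = mpol.subspace_add[OF W_subspace]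
lemmas W_scale = mpol.subspace_scale[OF W_subspace]
lemmas W_diff = mpol.subspace_diff[OF W_subspace]
lemmas W_neg = mpol.subspace_neg[OF W_subspace]
lemmas W_zero [simp] = mpol.subspace_0[OF W_subspace]

lemma W_scale_iff: "k \<noteq> 0 \<Longrightarrow> k \<cdot> f \<in> W \<longleftrightarrow> f \<in> W"
  using W_scale[of f k] W_scale[of "k \<cdot> f" "inverse k"] by auto

lemma W_gen: "u \<in> {1..2*m+2} \<Longrightarrow> v \<in> {1..2*m+2} \<Longrightarrow> f \<in> W \<Longrightarrow> piM n c S a (gen m u v) f \<in> W"
  using sub gen_in_sp[of u m v, where 'a = 'a] unfolding submodule_def by blast

lemma d_I: "u \<in> I \<Longrightarrow> d u \<in> I" and d_d: "u \<in> I \<Longrightarrow> d (d u) = u"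
  and eps_d: "u \<in> I \<Longrightarrow> \<epsilon> (d u) = - \<epsilon> u"
  using n by (auto simp: dual_def eps_def)

lemma z_le: "z \<le> n" and d_last: "d (n + 1) = z" and eps_last: "\<epsilon> (n + 1) = - 1"
  using n by (simp_all add: dual_def eps_def)

lemma eps_sq: "\<epsilon> u * \<epsilon> u = 1"
  by (simp add: eps_def)

text \<open>Here the vanishing of a at z enters: \<open>P z\<close> is a true derivative and so
  lowers degrees.\<close>

lemma Pz: "P z f = pdx z f"
  using zS az by (simp add: Pop_def dxa_def)

lemma Xz: "X z f = mulx z f"
  using zS by (simp add: Xop_def)

lemma W_Pz: assumes "f \<in> W" shows "P z f \<in> W"
proof -
  have "piM n c S a (gen m (n + 1) z) f \<in> W"
    by (intro W_gen assms) (use n assms in auto)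
  also have "piM n c S a (gen m (n + 1) z) f = - (2 \<cdot> P z f)"
    using n by (simp add: piM_gen piM_matE piE_def eps_def dual_def psmult_two)
  finally have "2 \<cdot> P z f \<in> W" using W_neg by fastforce
  thus ?thesis by (subst (asm) W_scale_iff) auto
qed

lemma W_Xz: assumes "f \<in> W" shows "X z (D f + c \<cdot> f) \<in> W"
proof -
  have "piM n c S a (gen m z (n + 1)) f \<in> W"
    by (intro W_gen assms) (use n assms in auto)
  also have "piM n c S a (gen m z (n + 1)) f = 2 \<cdot> X z (D f + c \<cdot> f)"
    using n by (simp add: piM_gen piM_matE piE_def eps_def dual_def psmult_two)
  finally show ?thesis by (subst (asm) W_scale_iff) auto
qed

lemma W_K: assumes "f \<in> W" shows "X z (P z f) + D f + c \<cdot> f \<in> W"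
proof -
  have "piM n c S a (gen m z z) f \<in> W"
    by (intro W_gen assms) (use n assms in auto)
  thus ?thesis
    using n by (simp add: piM_gen piM_matE piH_def eps_def dual_def)
qed

lemma W_lower: assumes "u \<in> I" "f \<in> W" shows "P u f - \<epsilon> u \<cdot> X (d u) (P z f) \<in> W"
proof -
  have "piM n c S a (gen m (n + 1) u) f \<in> W"
    by (intro W_gen assms) (use n assms in auto)
  also have "piM n c S a (gen m (n + 1) u) f = - (P u f - \<epsilon> u \<cdot> X (d u) (P z f))"
    using d_I[OF assms(1)] assms(1) z_le d_last eps_last
    by (auto simp: piM_gen piM_matE piE_def simp del: One_nat_def)
  finally show ?thesis using W_neg by fastforce
qed

lemma W_raise: assumes "u \<in> I" "f \<in> W" shows "X u (D f + c \<cdot> f) + \<epsilon> u \<cdot> X z (P (d u) f) \<in> W"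
proof -
  have "piM n c S a (gen m u (n + 1)) f \<in> W"
    by (intro W_gen assms) (use n assms in auto)
  also have "piM n c S a (gen m u (n + 1)) f = X u (D f + c \<cdot> f) + \<epsilon> u \<cdot> X z (P (d u) f)"
    using d_I[OF assms(1)] assms(1) z_le d_last eps_last
    by (auto simp: piM_gen piM_matE piE_def simp del: One_nat_def)
  finally show ?thesis .
qed

lemma W_quad:
  assumes "u \<in> I" "v \<in> I" "f \<in> W"
  shows "X u (P v f) - (\<epsilon> u * \<epsilon> v) \<cdot> X (d v) (P (d u) f) \<in> W"
proof -
  have "piM n c S a (gen m u v) f \<in> W"
    by (intro W_gen assms) (use n assms in auto)
  also have "piM n c S a (gen m u v) f = X u (P v f) - (\<epsilon> u * \<epsilon> v) \<cdot> X (d v) (P (d u) f)"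
  proof -
    have "d v \<noteq> d u" if "u \<noteq> v" using that d_d assms by metis
    thus ?thesis using assms d_I[OF assms(1)] d_I[OF assms(2)]
      by (cases "u = v") (auto simp: piM_gen piM_matE piE_def piH_def eps_sq simp del: One_nat_def)
  qed
  finally show ?thesis .
qed

text \<open>For dual indices both terms of \<open>W_quad\<close> coincide; division by 2 leaves a
  single product, the action of a long root vector.\<close>

lemma W_long: assumes "u \<in> I" "f \<in> W" shows "X (d u) (P u f) \<in> W"
proof -
  have "X (d u) (P u f) - (\<epsilon> (d u) * \<epsilon> u) \<cdot> X (d u) (P (d (d u)) f) \<in> W"
    by (intro W_quad d_I assms)
  also have "X (d u) (P u f) - (\<epsilon> (d u) * \<epsilon> u) \<cdot> X (d u) (P (d (d u)) f) = 2 \<cdot> X (d u) (P u f)"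
    using assms by (simp add: eps_d d_d eps_sq psmult_two)
  finally show ?thesis by (subst (asm) W_scale_iff) auto
qed

end

section \<open>Minimal elements and raising degrees\<close>

definition wt :: "(nat \<Rightarrow> nat) \<Rightarrow> nat \<Rightarrow> (nat \<Rightarrow>\<^sub>0 nat) \<Rightarrow> nat" where
  "wt w n \<alpha> = (\<Sum>i=1..n. w i * coef \<alpha> i)"

abbreviation deg :: "nat \<Rightarrow> (nat \<Rightarrow>\<^sub>0 nat) \<Rightarrow> nat" where
  "deg \<equiv> wt (\<lambda>_. 1)"

lemma wt_add: "wt w n (\<alpha> + \<beta>) = wt w n \<alpha> + wt w n \<beta>"
  by (simp add: wt_def lookup_add sum.distrib algebra_simps)

lemma wt_unit [simp]: "i \<in> {1..n} \<Longrightarrow> wt w n (\<e> i) = w i"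
proof -
  assume "i \<in> {1..n}"
  moreover have "wt w n (\<e> i) = (\<Sum>j=1..n. if i = j then w j else 0)"
    unfolding wt_def by (intro sum.cong refl) (simp add: lookup_single when_def)
  ultimately show ?thesis by simp
qed

lemma wt_zero [simp]: "wt w n 0 = 0"
  by (simp add: wt_def)

lemma keys_pdx: "\<beta> \<in> Poly_Mapping.keys (pdx i f) \<Longrightarrow> \<beta> + \<e> i \<in> Poly_Mapping.keys f"
  by (auto simp: in_keys_iff coef_pdx)

lemma keys_mulx:
  "\<beta> \<in> Poly_Mapping.keys (mulx i f) \<Longrightarrow> coef \<beta> i \<noteq> 0 \<and> \<beta> - \<e> i \<in> Poly_Mapping.keys f"
  by (auto simp: in_keys_iff coef_mulx split: if_splits)

text \<open>Take f minimising the largest weight of its monomials. The criterion compares monomials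
  one at a time, so that an operator lowering weights can be checked on \<open>keys\<close> without
  computing a maximum.\<close>

lemma minimal_weight:
  fixes w :: "(nat \<Rightarrow>\<^sub>0 nat) \<Rightarrow> nat" and Q :: "('a::comm_ring_1) mpol set"
  assumes "f0 \<in> Q" "f0 \<noteq> 0"
  obtains f where "f \<in> Q" "f \<noteq> 0"
    "\<And>g. g \<in> Q \<Longrightarrow>
       (\<And>\<beta>. \<beta> \<in> Poly_Mapping.keys g \<Longrightarrow> \<exists>\<alpha>\<in>Poly_Mapping.keys f. w \<beta> < w \<alpha>) \<Longrightarrow> g = 0"
proof -
  let ?\<mu> = "\<lambda>f. Max (w ` Poly_Mapping.keys f)"
  obtain f where f: "f \<in> Q \<and> f \<noteq> 0" and le: "\<And>g. g \<in> Q \<and> g \<noteq> 0 \<Longrightarrow> ?\<mu> f \<le> ?\<mu> g"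
    using ex_has_least_nat[of "\<lambda>f. f \<in> Q \<and> f \<noteq> 0" f0 ?\<mu>] assms by blast
  have "g = 0" if g: "g \<in> Q"
    and *: "\<And>\<beta>. \<beta> \<in> Poly_Mapping.keys g \<Longrightarrow> \<exists>\<alpha>\<in>Poly_Mapping.keys f. w \<beta> < w \<alpha>" for g
  proof (rule ccontr)
    assume "g \<noteq> 0"
    hence "w ` Poly_Mapping.keys g \<noteq> {}" by simp
    hence "?\<mu> g \<in> w ` Poly_Mapping.keys g" by (intro Max_in) auto
    then obtain \<beta> where \<beta>: "\<beta> \<in> Poly_Mapping.keys g" "?\<mu> g = w \<beta>" by auto
    from *[OF \<beta>(1)] obtain \<alpha> where "\<alpha> \<in> Poly_Mapping.keys f" "w \<beta> < w \<alpha>" by auto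
    moreover from this have "w \<alpha> \<le> ?\<mu> f" by (intro Max_ge) auto
    moreover have "?\<mu> f \<le> ?\<mu> g" using le g \<open>g \<noteq> 0\<close> by blast
    ultimately show False using \<beta>(2) by linarith
  qed
  with f show ?thesis using that by blast
qed

lemma exp_split:
  assumes "\<alpha> \<noteq> 0" "Poly_Mapping.keys \<alpha> \<subseteq> {1..n}"
  obtains i where "i \<in> {1..n}" "coef \<alpha> i \<noteq> 0" "\<alpha> - \<e> i + \<e> i = \<alpha>"
proof -
  from assms(1) obtain i where "i \<in> Poly_Mapping.keys \<alpha>" by (metis ex_in_conv keys_eq_empty)
  hence "i \<in> {1..n}" "coef \<alpha> i \<noteq> 0" using assms(2) by (auto simp only: in_keys_iff)
  thus ?thesis using that unit_exp_le by blast
qed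

lemma keys_diff_exp: "Poly_Mapping.keys (\<alpha> - \<beta>) \<subseteq> Poly_Mapping.keys \<alpha>" for \<alpha> :: "nat \<Rightarrow>\<^sub>0 nat"
  by (auto simp: in_keys_iff lookup_minus)

lemma constant_if_pdx_zero:
  fixes f :: "('a::field_char_0) mpol"
  assumes "f \<in> polys n" "\<And>i. i \<in> {1..n} \<Longrightarrow> pdx i f = 0"
  shows "f = coef f 0 \<cdot> 1"
proof (rule poly_mapping_eqI)
  fix \<alpha>
  show "coef f \<alpha> = coef (coef f 0 \<cdot> 1) \<alpha>"
  proof (cases "\<alpha> = 0 \<or> coef f \<alpha> = 0")
    case False
    hence "Poly_Mapping.keys \<alpha> \<subseteq> {1..n}" using assms(1) by (auto simp: polys_def in_keys_iff)
    then obtain i where i: "i \<in> {1..n}" "coef \<alpha> i \<noteq> 0" "\<alpha> - \<e> i + \<e> i = \<alpha>"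
      using exp_split False by blast
    have "coef (pdx i f) (\<alpha> - \<e> i) = 0" using assms(2)[OF i(1)] by simp
    hence "coef f \<alpha> = 0" by (auto simp: coef_pdx i simp del: of_nat_Suc simp flip: of_nat_Suc)
    thus ?thesis using False by simp
  qed (auto simp: lookup_one when_def)
qed

lemma poly_in_subspace:
  assumes "mpol.subspace W" "\<And>\<alpha>. \<alpha> \<in> Poly_Mapping.keys f \<Longrightarrow> mon \<alpha> \<in> W"
  shows "f \<in> W"
  by (subst mpol_expand) (intro mpol.subspace_sum mpol.subspace_scale assms)

lemma polys_subset:
  assumes "mpol.subspace W" "\<And>\<alpha>. Poly_Mapping.keys \<alpha> \<subseteq> {1..n} \<Longrightarrow> mon \<alpha> \<in> W"
  shows "polys n \<subseteq> W"
proof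
  fix f :: "'a mpol" assume "f \<in> polys n"
  hence "\<And>\<alpha>. \<alpha> \<in> Poly_Mapping.keys f \<Longrightarrow> mon \<alpha> \<in> W" using assms(2) unfolding polys_def by blast
  thus "f \<in> W" by (rule poly_in_subspace[OF assms(1)])
qed

text \<open>The eigenvalue of \<open>X\<^sub>s P\<^sub>s\<close> on \<open>x\<^sup>\<alpha>\<close>.\<close>

definition euler :: "nat set \<Rightarrow> (nat \<Rightarrow>\<^sub>0 nat) \<Rightarrow> nat \<Rightarrow> int" where
  "euler S \<alpha> s = (if s \<in> S then - int (coef \<alpha> s) - 1 else int (coef \<alpha> s))"

lemma coef_Xop_Pop:
  "coef (Xop S (\<lambda>_. 0) s (Pop S (\<lambda>_. 0) s f)) \<alpha> = of_int (euler S \<alpha> s) * coef f \<alpha>"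
  using unit_exp_le[of \<alpha> s]
  by (cases "coef \<alpha> s = 0") (auto simp: Xop_def Pop_def euler_def coef_simps algebra_simps)

lemma coef_Dop:
  "coef (Dop n S (\<lambda>_. 0) f) \<alpha> = of_int (\<Sum>s=1..n. euler S \<alpha> s) * coef f \<alpha>"
  by (simp add: Dop_def lookup_sum coef_Xop_Pop sum_distrib_right)

lemma Dop_mon: "Dop n {} (\<lambda>_. 0) (mon \<alpha>) = of_nat (deg n \<alpha>) \<cdot> mon \<alpha>"
  by (rule poly_mapping_eqI) (auto simp: coef_Dop euler_def wt_def lookup_single when_def)

context sp_submodule
begin

text \<open>In minimal degree every derivative that stays in W must vanish. This applies to
  \<open>P z\<close> at once; for the other variables each case has to bring the derivative into
  W.\<close>

lemma nonzero_min_degree: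
  assumes "W \<noteq> {0}"
  obtains f where "f \<in> W" "f \<noteq> 0" "P z f = 0"
    "\<And>i. i \<in> {1..n} \<Longrightarrow> pdx i f \<in> W \<Longrightarrow> pdx i f = 0"
proof -
  obtain f0 where "f0 \<in> W" "f0 \<noteq> 0" using assms W_zero by blast
  then obtain f where f: "f \<in> W" "f \<noteq> 0" and min: "\<And>g. g \<in> W \<Longrightarrow>
     (\<And>\<beta>. \<beta> \<in> Poly_Mapping.keys g \<Longrightarrow> \<exists>\<alpha>\<in>Poly_Mapping.keys f. deg n \<beta> < deg n \<alpha>) \<Longrightarrow> g = 0"
    using minimal_weight[where w = "deg n"] by metis
  have *: "pdx i f = 0" if "i \<in> {1..n}" "pdx i f \<in> W" for i
    using that by (intro min) (auto dest!: keys_pdx simp: wt_add intro!: bexI[of _ "_ + \<e> i"])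
  moreover have "P z f = 0"
    using *[of z] W_Pz[OF f(1)] z_le unfolding Pz by simp
  ultimately show ?thesis using f that by blast
qed

end

section \<open>The untwisted module with S empty\<close>

locale sp_submodule_std = sp_submodule m n c "{}" "\<lambda>_. 0" W for m n c W
begin

lemma X_mulx: "X u f = mulx u f" and P_pdx: "P u f = pdx u f"
  by (simp_all add: Xop_def Pop_def dxa_def)

text \<open>With \<open>P z f = 0\<close> the correction in \<open>W_lower\<close> disappears, so
  every derivative of f lies in W and vanishes by minimality.\<close>

lemma one_in_W:
  assumes "W \<noteq> {0}"
  shows "1 \<in> W"
proof -
  obtain f where f: "f \<in> W" "f \<noteq> 0" "P z f = 0"
    and min: "\<And>i. i \<in> {1..n} \<Longrightarrow> pdx i f \<in> W \<Longrightarrow> pdx i f = 0"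
    using nonzero_min_degree assms by metis
  have "pdx i f = 0" if "i \<in> {1..n}" for i
  proof (cases "i = z")
    case False
    hence "P i f \<in> W" using W_lower[of i f] that f by simp
    thus ?thesis using min that by (simp add: P_pdx)
  qed (use f in \<open>simp add: P_pdx\<close>)
  hence *: "f = coef f 0 \<cdot> 1" using constant_if_pdx_zero W_polys f by blast
  moreover from this have "coef f 0 \<noteq> 0" using f(2) by (metis mpol.scale_zero_left)
  ultimately show ?thesis using f(1) W_scale_iff by metis
qed

lemma D_mon: "D (mon \<alpha>) + c \<cdot> mon \<alpha> = (c + of_nat (deg n \<alpha>)) \<cdot> mon \<alpha>"
  by (simp add: Dop_mon mpol.scale_left_distrib add.commute)

text \<open>Applied to x^\<beta> of degree k, the raising operator gives (c + k) x_u x^\<beta> plus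
  a multiple of x_z d_u' x^\<beta>; the latter has degree k again and is already in W.\<close>

lemma raise_degree:
  assumes k: "\<And>\<alpha>. Poly_Mapping.keys \<alpha> \<subseteq> {1..n} \<Longrightarrow> deg n \<alpha> = k \<Longrightarrow> mon \<alpha> \<in> W"
    and ck: "c + of_nat k \<noteq> 0"
    and \<alpha>: "Poly_Mapping.keys \<alpha> \<subseteq> {1..n}" "deg n \<alpha> = Suc k"
  shows "mon \<alpha> \<in> W"
proof -
  have "\<alpha> \<noteq> 0" using \<alpha>(2) by auto
  then obtain u where u: "u \<in> {1..n}" "coef \<alpha> u \<noteq> 0" "\<alpha> - \<e> u + \<e> u = \<alpha>"
    using exp_split \<alpha>(1) by blast
  define \<beta> where "\<beta> = \<alpha> - \<e> u"
  have \<beta>\<alpha>: "\<alpha> = \<beta> + \<e> u" using u by (simp add: \<beta>_def)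
  have \<beta>: "Poly_Mapping.keys \<beta> \<subseteq> {1..n}" "deg n \<beta> = k"
    using keys_diff_exp[of \<alpha> "\<e> u"] \<alpha> u(1) unfolding \<beta>_def[symmetric] by (auto simp: \<beta>\<alpha> wt_add)
  have \<beta>W: "mon \<beta> \<in> W" using k \<beta> by blast
  show ?thesis
  proof (cases "u = z")
    case True
    have "X z (D (mon \<beta>) + c \<cdot> mon \<beta>) \<in> W" using W_Xz \<beta>W by blast
    also have "X z (D (mon \<beta>) + c \<cdot> mon \<beta>) = (c + of_nat k) \<cdot> mon \<alpha>"
      using \<beta>\<alpha> True \<beta>(2) by (simp add: D_mon X_mulx mulx_psmult mulx_mon)
    finally show ?thesis using ck W_scale_iff by blast
  next
    case False
    hence uI: "u \<in> I" using u by auto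
    have *: "X z (P (d u) (mon \<beta>)) \<in> W"
    proof (cases "coef \<beta> (d u) = 0")
      case False
      have \<gamma>: "\<beta> - \<e> (d u) + \<e> (d u) = \<beta>" using False by (rule unit_exp_le)
      let ?\<gamma> = "\<beta> - \<e> (d u) + \<e> z"
      have "deg n (\<beta> - \<e> (d u) + \<e> (d u)) = k" using \<gamma> \<beta> by simp
      hence "deg n ?\<gamma> = k" using d_I[OF uI] n by (simp add: wt_add)
      moreover have "Poly_Mapping.keys ?\<gamma> \<subseteq> {1..n}"
        using keys_diff_exp[of \<beta> "\<e> (d u)"] \<beta>(1) n keys_add[of "\<beta> - \<e> (d u)" "\<e> z"] by fastforce
      ultimately have "mon ?\<gamma> \<in> W" by (intro k)
      thus ?thesis by (simp add: X_mulx P_pdx pdx_mon mulx_psmult mulx_mon W_scale)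
    qed (simp add: X_mulx P_pdx pdx_mon)
    have "X u (D (mon \<beta>) + c \<cdot> mon \<beta>) + \<epsilon> u \<cdot> X z (P (d u) (mon \<beta>)) \<in> W"
      using W_raise uI \<beta>W by blast
    from W_diff[OF this W_scale[OF *, of "\<epsilon> u"]]
    have "X u (D (mon \<beta>) + c \<cdot> mon \<beta>) \<in> W" by simp
    also have "X u (D (mon \<beta>) + c \<cdot> mon \<beta>) = (c + of_nat k) \<cdot> mon \<alpha>"
      using \<beta>\<alpha> \<beta>(2) by (simp add: D_mon X_mulx mulx_psmult mulx_mon)
    finally show ?thesis using ck W_scale_iff by blast
  qed
qed

text \<open>The starting degree is kept general: 0 for the climb from 1, and k + 1 for the climb
  beyond the obstruction at c = -k.\<close>

lemma raise_degree_range: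
  assumes "\<And>\<alpha>. Poly_Mapping.keys \<alpha> \<subseteq> {1..n} \<Longrightarrow> deg n \<alpha> = k \<Longrightarrow> mon \<alpha> \<in> W"
    and "\<And>j. k \<le> j \<Longrightarrow> j < l \<Longrightarrow> c + of_nat j \<noteq> 0"
    and "k \<le> l" "Poly_Mapping.keys \<alpha> \<subseteq> {1..n}" "deg n \<alpha> = l"
  shows "mon \<alpha> \<in> W"
  using assms(3,2,4,5)
proof (induction l arbitrary: \<alpha> rule: dec_induct)
  case base
  thus ?case using assms(1) by blast
next
  case (step l)
  show ?case
  proof (rule raise_degree[of l])
    show "c + of_nat l \<noteq> 0" using step by simp
  qed (use step in auto)
qed

lemma mon_from_one:
  assumes "1 \<in> W" and "\<And>j. j < deg n \<alpha> \<Longrightarrow> c + of_nat j \<noteq> 0" "Poly_Mapping.keys \<alpha> \<subseteq> {1..n}"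
  shows "mon \<alpha> \<in> W"
proof (rule raise_degree_range[of 0 "deg n \<alpha>"])
  fix \<beta> assume \<beta>: "Poly_Mapping.keys \<beta> \<subseteq> {1..n}" "deg n \<beta> = 0"
  have "\<beta> = 0"
  proof (rule ccontr)
    assume "\<beta> \<noteq> 0"
    then obtain i where "i \<in> {1..n}" "\<beta> - \<e> i + \<e> i = \<beta>" using exp_split \<beta>(1) by blast
    thus False using \<beta>(2) wt_add[of _ n "\<beta> - \<e> i" "\<e> i"] by simp
  qed
  thus "mon \<beta> \<in> W" using assms(1) by simp
qed (use assms in auto)

lemma irreducible:
  assumes "\<And>k. c \<noteq> - of_nat k" "W \<noteq> {0}"
  shows "W = polys n"
proof
  show "polys n \<subseteq> W"
  proof (rule polys_subset[OF W_subspace], rule mon_from_one)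
    fix j show "c + of_nat j \<noteq> 0" using assms(1)[of j] by (simp add: add_eq_0_iff2)
  qed (use one_in_W assms in auto)
qed (use W_polys in auto)

end

section \<open>Nonintegral parameter\<close>

text \<open>This is simplicity of the polynomial module over the Weyl algebra, with M closed under
  scaling but not under sums: it will be a set of eigenvectors for varying eigenvalues.\<close>

lemma weyl_closed:
  fixes M :: "('a::field_char_0) mpol set"
  assumes M: "M \<subseteq> polys n" "f0 \<in> M" "f0 \<noteq> 0"
    and scale: "\<And>k f. f \<in> M \<Longrightarrow> k \<cdot> f \<in> M"
    and mulx: "\<And>i f. f \<in> M \<Longrightarrow> i \<in> {1..n} \<Longrightarrow> mulx i f \<in> M"
    and pdx: "\<And>i f. f \<in> M \<Longrightarrow> i \<in> {1..n} \<Longrightarrow> pdx i f \<in> M"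
    and "Poly_Mapping.keys \<alpha> \<subseteq> {1..n}"
  shows "mon \<alpha> \<in> M"
proof -
  obtain f where f: "f \<in> M" "f \<noteq> 0" and min: "\<And>g. g \<in> M \<Longrightarrow>
     (\<And>\<beta>. \<beta> \<in> Poly_Mapping.keys g \<Longrightarrow> \<exists>\<alpha>\<in>Poly_Mapping.keys f. deg n \<beta> < deg n \<alpha>) \<Longrightarrow> g = 0"
    using minimal_weight[where w = "deg n"] M(2,3) by metis
  have "pdx i f = 0" if "i \<in> {1..n}" for i
    using that pdx f by (intro min) (auto dest!: keys_pdx simp: wt_add intro!: bexI[of _ "_ + \<e> i"])
  hence *: "f = coef f 0 \<cdot> 1" using constant_if_pdx_zero M f by blast
  hence "coef f 0 \<noteq> 0" using f(2) by (metis mpol.scale_zero_left)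
  hence "1 = inverse (coef f 0) \<cdot> f" by (subst *) simp
  hence one: "1 \<in> M" using scale[OF f(1)] by metis
  show ?thesis using assms(7)
  proof (induction "deg n \<alpha>" arbitrary: \<alpha> rule: less_induct)
    case less
    show ?case
    proof (cases "\<alpha> = 0")
      case False
      then obtain i where i: "i \<in> {1..n}" "\<alpha> - \<e> i + \<e> i = \<alpha>" using exp_split less(2) by blast
      have "deg n (\<alpha> - \<e> i) < deg n \<alpha>" using wt_add[of _ n "\<alpha> - \<e> i" "\<e> i"] i by simp
      hence "mon (\<alpha> - \<e> i) \<in> M" using less keys_diff_exp by blast
      from mulx[OF this i(1)] show ?thesis by (simp add: mulx_mon i)
    qed (use one in simp)
  qed
qed

section \<open>Joint eigenvectors of D and X_z P_z\<close>

context sp_submodule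
begin

text \<open>D is the Euler operator of the Weyl algebra: by the canonical relations alone each
  \<open>X r\<close> raises its eigenvalue by one, and each \<open>P r\<close> lowers it.\<close>

lemma D_X: assumes "r \<in> {1..n}" shows "D (X r f) = X r (D f) + X r f"
proof -
  have "D (X r f) = (\<Sum>s=1..n. X r (X s (P s f)) + (if s = r then X s f else 0))"
    unfolding Dop_def by (intro sum.cong refl) (auto simp: Pop_Xop op_add Xop_commute[of S a r])
  also have "\<dots> = X r (D f) + X r f"
    using assms by (simp add: sum.distrib Dop_def module_hom.sum[OF lin_Xop])
  finally show ?thesis .
qed

lemma D_P: assumes "r \<in> {1..n}" shows "D (P r f) = P r (D f) - P r f"
proof -
  have "X s (P s (P r f)) = P r (X s (P s f)) - (if s = r then P s f else 0)" for s
    by (simp add: Pop_Xop Pop_commute[of S a r s])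
  hence "D (P r f) = (\<Sum>s=1..n. P r (X s (P s f)) - (if s = r then P s f else 0))"
    unfolding Dop_def by (intro sum.cong refl)
  also have "\<dots> = P r (D f) - P r f"
    using assms by (simp add: sum_subtractf Dop_def module_hom.sum[OF lin_Pop])
  finally show ?thesis .
qed

lemma z_in: "z \<in> {1..n}"
  using n by simp

text \<open>Integer eigenvalues are what occurs for a = 0, where both operators are diagonal on
  monomials. They guarantee that adding a nonintegral c never gives 0.\<close>

definition bigrade :: "int \<Rightarrow> int \<Rightarrow> 'a mpol \<Rightarrow> bool" where
  "bigrade p k f \<longleftrightarrow> D f = of_int p \<cdot> f \<and> X z (P z f) = of_int k \<cdot> f"

lemma bigrade_X: "r \<in> I \<Longrightarrow> bigrade p k f \<Longrightarrow> bigrade (p + 1) k (X r f)"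
  by (simp add: bigrade_def D_X Pop_Xop op_scale mpol.scale_left_distrib Xop_commute[of S a z r] del: One_nat_def)

lemma bigrade_P: "r \<in> I \<Longrightarrow> bigrade p k f \<Longrightarrow> bigrade (p - 1) k (P r f)"
proof -
  assume r: "r \<in> I" and f: "bigrade p k f"
  have "X z (P z (P r f)) = P r (X z (P z f))"
    using r by (simp add: Pop_Xop Pop_commute[of S a z r] del: One_nat_def)
  thus ?thesis using r f by (simp add: bigrade_def D_P op_scale mpol.scale_left_diff_distrib)
qed

lemma bigrade_Xz: "bigrade p k f \<Longrightarrow> bigrade (p + 1) (k + 1) (X z f)"
  using z_in by (simp add: bigrade_def D_X Pop_Xop op_scale op_add mpol.scale_left_distrib)

lemma bigrade_Pz: "bigrade p k f \<Longrightarrow> bigrade (p - 1) (k - 1) (P z f)"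
proof -
  assume f: "bigrade p k f"
  have "X z (P z (P z f)) = P z (X z (P z f)) - P z f" by (simp add: Pop_Xop)
  thus ?thesis using f z_in by (simp add: bigrade_def D_P op_scale mpol.scale_left_diff_distrib)
qed

text \<open>For a joint eigenvector \<open>f\<close> of \<open>D\<close> and \<open>X\<^sub>z P\<^sub>z\<close> with eigenvalues \<open>p\<close> and \<open>k\<close>, the raising
  operator and the lowering operator composed with \<open>X\<^sub>z\<close> give two combinations of \<open>X\<^sub>r f\<close>
  and \<open>X\<^sub>z P\<^sub>r\<^sub>' f\<close>, whose determinant \<open>p + c - (k + 1)\<close> is nonzero for nonintegral \<open>c\<close>.\<close>

lemma bigrade_X_in_W:
  assumes f: "f \<in> W" "bigrade p k f" and c: "c \<notin> \<int>" and r: "r \<in> I"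
  shows "X r f \<in> W"
proof -
  have pc: "of_int p + c \<noteq> 0"
    using c by (metis Ints_minus Ints_of_int add_eq_0_iff)
  have "X z (D f + c \<cdot> f) \<in> W" using W_Xz f by blast
  also have "X z (D f + c \<cdot> f) = (of_int p + c) \<cdot> X z f"
    using f by (simp add: bigrade_def op_scale op_add mpol.scale_left_distrib)
  finally have Xzf: "X z f \<in> W" using pc W_scale_iff by blast
  have "P (d r) (X z f) - \<epsilon> (d r) \<cdot> X (d (d r)) (P z (X z f)) \<in> W"
    by (intro W_lower d_I r Xzf)
  moreover have "P (d r) (X z f) = X z (P (d r) f)"
    using d_I[OF r] by (simp add: Pop_Xop)
  moreover have "P z (X z f) = (of_int k + 1) \<cdot> f"
    using f by (simp add: Pop_Xop bigrade_def mpol.scale_left_distrib)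
  ultimately have "X z (P (d r) f) + (\<epsilon> r * (of_int k + 1)) \<cdot> X r f \<in> W"
    using r by (simp add: d_d eps_d op_scale)
  from W_scale[OF this, of "\<epsilon> r"]
  have 2: "\<epsilon> r \<cdot> X z (P (d r) f) + (of_int k + 1) \<cdot> X r f \<in> W"
    by (simp add: mpol.scale_right_distrib eps_sq flip: mult.assoc)
  have "X r (D f + c \<cdot> f) + \<epsilon> r \<cdot> X z (P (d r) f) \<in> W" using W_raise r f by blast
  hence 1: "(of_int p + c) \<cdot> X r f + \<epsilon> r \<cdot> X z (P (d r) f) \<in> W"
    using f by (simp add: bigrade_def op_scale op_add mpol.scale_left_distrib)
  have "(of_int p + c - (of_int k + 1)) \<cdot> X r f \<in> W"
    using W_diff[OF 1 2] by (simp add: mpol.scale_left_diff_distrib)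
  moreover have "of_int p + c - (of_int k + 1) \<noteq> 0"
  proof
    assume "of_int p + c - (of_int k + 1) = 0"
    hence "c = of_int (k + 1 - p)" by (simp add: algebra_simps)
    thus False using c by simp
  qed
  ultimately show ?thesis using W_scale_iff by blast
qed

text \<open>\<open>P z f\<close> is again a joint eigenvector in W, so \<open>bigrade_X_in_W\<close>
  supplies the correction term of \<open>W_lower\<close>.\<close>

lemma bigrade_P_in_W:
  assumes f: "f \<in> W" "bigrade p k f" and c: "c \<notin> \<int>" and r: "r \<in> I"
  shows "P r f \<in> W"
proof -
  have "X (d r) (P z f) \<in> W"
    using bigrade_X_in_W[OF W_Pz[OF f(1)] bigrade_Pz[OF f(2)] c d_I[OF r]] .
  from W_add[OF W_lower[OF r f(1)] W_scale[OF this]] show ?thesis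
    by (metis diff_add_cancel)
qed

lemma bigrade_Xz_in_W:
  assumes f: "f \<in> W" "bigrade p k f" and c: "c \<notin> \<int>"
  shows "X z f \<in> W"
proof -
  have pc: "of_int p + c \<noteq> 0"
    using c by (metis Ints_minus Ints_of_int add_eq_0_iff)
  have "X z (D f + c \<cdot> f) \<in> W" using W_Xz f by blast
  also have "X z (D f + c \<cdot> f) = (of_int p + c) \<cdot> X z f"
    using f by (simp add: bigrade_def op_scale op_add mpol.scale_left_distrib)
  finally show ?thesis using pc W_scale_iff by blast
qed

lemma bigrade_scale: "bigrade p k f \<Longrightarrow> bigrade p k (t \<cdot> f)"
  by (simp add: bigrade_def op_scale mult.commute)

end

locale sp_submodule_weight = sp_submodule m n c S "\<lambda>_. 0" W for m n c S W
begin

text \<open>Take f with fewest monomials among the nonzero elements of W killed by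
  \<open>P z\<close>. On these \<open>W_K\<close> gives D f in W, and \<open>P z\<close> kills it
  too. As D is diagonal on monomials, subtracting the eigenvalue of one monomial of f removes that
  monomial, so the difference is 0.\<close>

lemma exists_bigraded:
  assumes "W \<noteq> {0}"
  obtains f p where "f \<in> W" "f \<noteq> 0" "bigrade p 0 f"
proof -
  obtain f0 where "f0 \<in> W" "f0 \<noteq> 0" "P z f0 = 0" using nonzero_min_degree[OF assms] by metis
  then obtain f where f: "f \<in> W" "f \<noteq> 0" "P z f = 0"
    and min: "\<And>g. g \<in> W \<Longrightarrow> g \<noteq> 0 \<Longrightarrow> P z g = 0 \<Longrightarrow>
      card (Poly_Mapping.keys f) \<le> card (Poly_Mapping.keys g)"
    using ex_has_least_nat[of "\<lambda>f. f \<in> W \<and> f \<noteq> 0 \<and> P z f = 0" f0 "\<lambda>f. card (Poly_Mapping.keys f)"]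
    by blast
  obtain \<alpha> where \<alpha>: "coef f \<alpha> \<noteq> 0" using f(2) by (metis poly_mapping_eqI lookup_zero)
  define p where "p = (\<Sum>s=1..n. euler S \<alpha> s)"
  define g where "g = D f - of_int p \<cdot> f"
  have "X z (P z f) + D f + c \<cdot> f \<in> W" using W_K f by blast
  from W_diff[OF this W_scale[OF f(1), of c]] have "D f \<in> W" using f by simp
  hence g: "g \<in> W" "P z g = 0"
    using f W_diff W_scale D_P[OF z_in, of f] by (simp_all add: g_def op_diff op_scale)
  have "Poly_Mapping.keys g \<subset> Poly_Mapping.keys f"
    using \<alpha> by (auto simp: g_def in_keys_iff lookup_minus coef_Dop p_def)
  hence "card (Poly_Mapping.keys g) < card (Poly_Mapping.keys f)"
    by (intro psubset_card_mono) auto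
  hence "g = 0" using min g by fastforce
  hence "bigrade p 0 f" using f by (simp add: bigrade_def g_def)
  thus ?thesis using that f by blast
qed

lemma irreducible:
  assumes "W \<noteq> {0}" and c: "c \<notin> \<int>"
  shows "W = polys n"
proof
  obtain f0 p where f0: "f0 \<in> W" "f0 \<noteq> 0" "bigrade p 0 f0" using exists_bigraded assms by metis
  define M where "M = {f \<in> W. \<exists>p k. bigrade p k f}"
  have XM: "X r f \<in> M" if "f \<in> M" "r \<in> {1..n}" for r f
    using that bigrade_X bigrade_Xz bigrade_X_in_W[OF _ _ c] bigrade_Xz_in_W[OF _ _ c]
    unfolding M_def by (cases "r = z") blast+
  have PM: "P r f \<in> M" if "f \<in> M" "r \<in> {1..n}" for r f
    using that bigrade_P bigrade_Pz bigrade_P_in_W[OF _ _ c] W_Pz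
    unfolding M_def by (cases "r = z") blast+
  have sM: "t \<cdot> f \<in> M" if "f \<in> M" for t f
    using that bigrade_scale W_scale unfolding M_def by blast
  have nM: "- f \<in> M" if "f \<in> M" for f
    using sM[OF that, of "-1"] by simp
  show "polys n \<subseteq> W"
  proof (rule polys_subset[OF W_subspace])
    fix \<alpha> :: "nat \<Rightarrow>\<^sub>0 nat" assume \<alpha>: "Poly_Mapping.keys \<alpha> \<subseteq> {1..n}"
    have "mon \<alpha> \<in> M"
    proof (rule weyl_closed[where n = n and ?f0.0 = f0])
      fix i f assume i: "i \<in> {1..n}" "f \<in> M"
      show "mulx i f \<in> M"
        using XM[OF i(2,1)] nM[OF PM[OF i(2,1)]] by (cases "i \<in> S") (auto simp: Xop_def Pop_def)
      show "pdx i f \<in> M"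
        using XM[OF i(2,1)] PM[OF i(2,1)] by (cases "i \<in> S") (auto simp: Xop_def Pop_def dxa_def)
    qed (use f0 \<alpha> sM W_polys in \<open>auto simp: M_def\<close>)
    thus "mon \<alpha> \<in> W" by (simp add: M_def)
  qed
qed (use W_polys in auto)

end

section \<open>Twisted modules\<close>

locale sp_submodule_twisted = sp_submodule +
  fixes v :: nat
  assumes vI: "v \<in> {1..n} - {m + 1}" and vS: "v \<notin> S" and av: "a v \<noteq> 0"
    and dS: "u \<in> S \<Longrightarrow> dual m u \<notin> S"
begin

lemma P_notin: "u \<notin> S \<Longrightarrow> P u f = pdx u f + a u \<cdot> f"
  by (simp add: Pop_def dxa_def)

text \<open>Outside S the lowering operators and minimality make f an eigenvector of
  \<open>P u\<close> with eigenvalue \<open>a u\<close>. The long root operator then gives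
  \<open>X (d v) f\<close>. For u in S the partner \<open>d u\<close> lies outside S, so the
  quadratic operator gives \<open>X u f\<close>, which is the derivative up to a multiple of
  f.\<close>

lemma one_in_W:
  assumes "W \<noteq> {0}"
  shows "1 \<in> W"
proof -
  obtain f where f: "f \<in> W" "f \<noteq> 0" "P z f = 0"
    and min: "\<And>i. i \<in> {1..n} \<Longrightarrow> pdx i f \<in> W \<Longrightarrow> pdx i f = 0"
    using nonzero_min_degree assms by metis
  have notin: "pdx u f = 0" if "u \<in> {1..n}" "u \<notin> S" for u
  proof (cases "u = z")
    case True
    show ?thesis using f(3) unfolding True Pz .
  next
    case False
    hence "P u f \<in> W" using W_lower[of u f] that f by simp
    from W_diff[OF this W_scale[OF f(1), of "a u"]] have "pdx u f \<in> W"
      by (simp add: P_notin that)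
    thus ?thesis using min that by blast
  qed
  have Pf: "P u f = a u \<cdot> f" if "u \<in> {1..n}" "u \<notin> S" for u
    using notin that P_notin by simp
  have Xf: "X (d v) f \<in> W"
    using W_long[OF vI f(1)] Pf[of v] vI vS av by (simp add: op_scale W_scale_iff)
  have "pdx u f = 0" if u: "u \<in> {1..n}" for u
  proof (cases "u \<in> S")
    case True
    hence uI: "u \<in> I" using u zS by auto
    have "P (d u) f = a (d u) \<cdot> f" using Pf d_I[OF uI] dS[OF True] by blast
    moreover have "P v f = a v \<cdot> f" using Pf vI vS by blast
    ultimately have "a v \<cdot> X u f - (\<epsilon> u * \<epsilon> v) \<cdot> a (d u) \<cdot> X (d v) f \<in> W"
      using W_quad[OF uI vI f(1)] by (simp add: op_scale mult.commute)
    from W_add[OF this W_scale[OF W_scale[OF Xf]]] have "a v \<cdot> X u f \<in> W"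
      by (metis diff_add_cancel)
    hence "X u f \<in> W" using av W_scale_iff by blast
    from W_diff[OF this W_scale[OF f(1), of "a u"]] have "pdx u f \<in> W"
      by (simp add: Xop_def dxa_def True)
    thus ?thesis using min u by blast
  qed (use u notin in auto)
  hence *: "f = coef f 0 \<cdot> 1" using constant_if_pdx_zero W_polys f by blast
  moreover from this have "coef f 0 \<noteq> 0" using f(2) by (metis mpol.scale_zero_left)
  ultimately show ?thesis using f(1) W_scale_iff by metis
qed

section \<open>Reaching the polynomials free of x_z\<close>

definition zfree :: "nat \<Rightarrow> 'a mpol set" where
  "zfree k = {f \<in> polys n. \<forall>\<alpha>\<in>Poly_Mapping.keys f. coef \<alpha> z = 0 \<and> deg n \<alpha> \<le> k}"

lemma zfree_subspace: "mpol.subspace (zfree k)"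
proof -
  have "zfree k = {f. Poly_Mapping.keys f \<subseteq> {\<alpha>. Poly_Mapping.keys \<alpha> \<subseteq> {1..n} \<and> coef \<alpha> z = 0 \<and> deg n \<alpha> \<le> k}}"
    unfolding zfree_def polys_def by blast
  thus ?thesis by (simp only: keys_subset_subspace)
qed

lemma zfree_pdx: "g \<in> zfree k \<Longrightarrow> i \<in> {1..n} \<Longrightarrow> pdx i g \<in> zfree k"
  by (fastforce simp: zfree_def pdx_polys lookup_add wt_add dest!: keys_pdx)

lemma zfree_mulx_pdx:
  assumes "g \<in> zfree k" "i \<in> I" "j \<in> I"
  shows "mulx i (pdx j g) \<in> zfree k"
proof -
  have "coef \<beta> z = 0 \<and> deg n \<beta> \<le> k" if "\<beta> \<in> Poly_Mapping.keys (mulx i (pdx j g))" for \<beta>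
  proof -
    have *: "coef \<beta> i \<noteq> 0" "\<beta> - \<e> i + \<e> j \<in> Poly_Mapping.keys g"
      using that keys_mulx keys_pdx by blast+
    have **: "coef (\<beta> - \<e> i + \<e> j) z = 0 \<and> deg n (\<beta> - \<e> i + \<e> j) \<le> k"
      using assms(1) *(2) by (auto simp: zfree_def)
    have \<beta>: "\<beta> - \<e> i + \<e> i = \<beta>" using *(1) by (rule unit_exp_le)
    have "deg n \<beta> = deg n (\<beta> - \<e> i + \<e> j)"
      using assms(2,3) by (subst \<beta>[symmetric]) (simp add: wt_add)
    moreover have "coef \<beta> z = coef (\<beta> - \<e> i + \<e> j) z"
      using assms(2,3) by (simp add: lookup_add lookup_minus lookup_single)
    ultimately show ?thesis using ** by simp
  qed
  thus ?thesis using assms by (auto simp: zfree_def mulx_polys pdx_polys)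
qed

text \<open>For i in S the operator \<open>X i\<close> is d_i + a_i and mixes degrees; this is why
  the spaces bound the degree instead of fixing it.\<close>

lemma zfree_X_pdx:
  assumes "g \<in> zfree k" "i \<in> I" "j \<in> I"
  shows "X i (pdx j g) \<in> zfree k"
proof (cases "i \<in> S")
  case True
  thus ?thesis using assms unfolding Xop_def dxa_def
    by (simp add: mpol.subspace_add[OF zfree_subspace] mpol.subspace_scale[OF zfree_subspace] zfree_pdx)
qed (use assms in \<open>simp add: Xop_def zfree_mulx_pdx\<close>)

lemma Pz_zfree: "g \<in> zfree k \<Longrightarrow> P z g = 0"
proof -
  assume g: "g \<in> zfree k"
  have "Poly_Mapping.keys (pdx z g) = {}"
    using g by (fastforce simp: zfree_def lookup_add dest!: keys_pdx)
  thus ?thesis unfolding Pz by simp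
qed

text \<open>In \<open>X u (P v g)\<close> = \<open>X u (pdx v g)\<close> + a_v \<open>X u g\<close>
  the first summand stays in \<open>zfree k\<close>, so dividing by a_v yields \<open>X u g\<close>
  once the left side lies in W. The long root operator provides this for u = \<open>d v\<close>, and
  the quadratic operators then provide it for every u.\<close>

lemma zfree_step:
  assumes k: "zfree k \<subseteq> W"
  shows "zfree (Suc k) \<subseteq> W"
proof -
  have PW: "P u g \<in> W" if "u \<in> I" "g \<in> W" "P z g = 0" for u g
    using W_lower[OF that(1,2)] that(3) by simp
  have XP: "X u (P v g) = X u (pdx v g) + a v \<cdot> X u g" for u g
    by (simp add: P_notin vS op_add op_scale)
  have X_if_XP: "X u g \<in> W" if g: "g \<in> zfree k" and u: "u \<in> I" and "X u (P v g) \<in> W" for u g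
  proof -
    have "X u (pdx v g) \<in> W" using zfree_X_pdx[OF g u vI] k by blast
    from W_diff[OF that(3) this] show ?thesis using av W_scale_iff by (simp add: XP)
  qed
  have Xdv: "X (d v) g \<in> W" if g: "g \<in> zfree k" for g
    using X_if_XP[OF g d_I[OF vI]] W_long[OF vI] g k by blast
  have Xu: "X u g \<in> W" if g: "g \<in> zfree k" and u: "u \<in> I" for u g
  proof (rule X_if_XP[OF g u])
    have gW: "g \<in> W" using g k by blast
    have "P z (X (d v) g) = X (d v) (P z g)"
      using d_I[OF vI] by (simp add: Pop_Xop)
    hence PX: "P (d u) (X (d v) g) \<in> W"
      using PW[OF d_I[OF u] Xdv[OF g]] Pz_zfree[OF g] by simp
    \<comment> \<open>With \<open>P (d u)\<close> moved outside, the lowering operator applies to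
      \<open>X (d v) g\<close>, which is already in W and free of x_z.\<close>
    have "X (d v) (P (d u) g) = P (d u) (X (d v) g) - (if d u = d v then g else 0)"
      by (simp add: Pop_Xop)
    hence "X (d v) (P (d u) g) \<in> W"
      using PX W_diff[OF PX gW] by (cases "d u = d v") simp_all
    from W_add[OF W_quad[OF u vI gW] W_scale[OF this]] show "X u (P v g) \<in> W"
      by (metis diff_add_cancel)
  qed
  have mulxW: "mulx u g \<in> W" if g: "g \<in> zfree k" and u: "u \<in> I" for u g
  proof (cases "u \<in> S")
    case True
    have "P u g \<in> W" using PW[OF u _ Pz_zfree[OF g]] g k by blast
    from W_neg[OF this] show ?thesis using True by (simp add: Pop_def)
  qed (use Xu[OF g u] in \<open>simp add: Xop_def\<close>)
  show ?thesis
  proof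
    fix f assume f: "f \<in> zfree (Suc k)"
    show "f \<in> W"
    proof (rule poly_in_subspace[OF W_subspace])
      fix \<alpha> assume "\<alpha> \<in> Poly_Mapping.keys f"
      hence \<alpha>: "Poly_Mapping.keys \<alpha> \<subseteq> {1..n}" "coef \<alpha> z = 0" "deg n \<alpha> \<le> Suc k"
        using f by (auto simp: zfree_def polys_def)
      show "mon \<alpha> \<in> W"
      proof (cases "\<alpha> = 0")
        case True
        have "mon 0 \<in> zfree k" by (simp add: zfree_def polys_def)
        thus ?thesis using k True by blast
      next
        case False
        then obtain i where i: "i \<in> {1..n}" "coef \<alpha> i \<noteq> 0" "\<alpha> - \<e> i + \<e> i = \<alpha>"
          using exp_split \<alpha>(1) by blast
        have "i \<in> I" using i \<alpha>(2) by auto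
        moreover have "mon (\<alpha> - \<e> i) \<in> zfree k"
          using wt_add[of "\<lambda>_. 1" n "\<alpha> - \<e> i" "\<e> i"] i \<alpha> keys_diff_exp[of \<alpha> "\<e> i"]
          by (auto simp: zfree_def lookup_minus)
        ultimately have "mulx i (mon (\<alpha> - \<e> i)) \<in> W" using mulxW by blast
        thus ?thesis by (simp add: mulx_mon i)
      qed
    qed
  qed
qed

lemma zfree_subset: "1 \<in> W \<Longrightarrow> zfree k \<subseteq> W"
proof (induction k)
  case 0
  have "mon \<alpha> \<in> W" if f: "f \<in> zfree 0" and \<alpha>: "\<alpha> \<in> Poly_Mapping.keys f" for f \<alpha>
  proof -
    have "\<alpha> = 0"
    proof (rule ccontr)
      assume "\<alpha> \<noteq> 0"
      have "Poly_Mapping.keys \<alpha> \<subseteq> {1..n}" and deg: "deg n \<alpha> = 0"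
        using f \<alpha> by (auto simp: zfree_def polys_def)
      then obtain i where "i \<in> {1..n}" "\<alpha> - \<e> i + \<e> i = \<alpha>"
        using exp_split \<open>\<alpha> \<noteq> 0\<close> by metis
      thus False using deg wt_add[of "\<lambda>_. 1" n "\<alpha> - \<e> i" "\<e> i"] by simp
    qed
    thus ?thesis using 0 by simp
  qed
  thus ?case using poly_in_subspace[OF W_subspace] by blast
qed (use zfree_step in auto)

section \<open>Adding powers of x_z\<close>

definition zbounded :: "nat \<Rightarrow> 'a mpol set" where
  "zbounded k = {f \<in> polys n. \<forall>\<alpha>\<in>Poly_Mapping.keys f. coef \<alpha> z \<le> k}"

lemma zbounded_subspace: "mpol.subspace (zbounded k)"
proof -
  have "zbounded k = {f. Poly_Mapping.keys f \<subseteq> {\<alpha>. Poly_Mapping.keys \<alpha> \<subseteq> {1..n} \<and> coef \<alpha> z \<le> k}}"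
    unfolding zbounded_def polys_def by blast
  thus ?thesis by (simp only: keys_subset_subspace)
qed

lemma zbounded_pdx: "g \<in> zbounded k \<Longrightarrow> pdx i g \<in> zbounded k"
  by (fastforce simp: zbounded_def pdx_polys lookup_add dest!: keys_pdx)

lemma zbounded_mulx:
  assumes "g \<in> zbounded k" "i \<in> I"
  shows "mulx i g \<in> zbounded k"
proof -
  have "coef \<beta> z \<le> k" if "\<beta> \<in> Poly_Mapping.keys (mulx i g)" for \<beta>
  proof -
    have "coef (\<beta> - \<e> i) z \<le> k" using keys_mulx[OF that] assms(1) unfolding zbounded_def by blast
    thus ?thesis using assms(2) by (simp add: lookup_minus lookup_single)
  qed
  thus ?thesis using assms mulx_polys[of g n i] unfolding zbounded_def by blast
qed

lemma zbounded_mulx_pdx: "g \<in> zbounded k \<Longrightarrow> mulx z (pdx z g) \<in> zbounded k"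
  using z_in
  by (fastforce simp: zbounded_def mulx_polys pdx_polys lookup_minus lookup_add dest!: keys_mulx keys_pdx)

lemma zbounded_dxa: "g \<in> zbounded k \<Longrightarrow> dxa a i g \<in> zbounded k"
  unfolding dxa_def
  by (intro mpol.subspace_add[OF zbounded_subspace] mpol.subspace_scale[OF zbounded_subspace] zbounded_pdx)

lemma zbounded_X: "g \<in> zbounded k \<Longrightarrow> i \<in> I \<Longrightarrow> X i g \<in> zbounded k"
  by (simp add: Xop_def zbounded_mulx zbounded_dxa)

lemma zbounded_P: "g \<in> zbounded k \<Longrightarrow> i \<in> I \<Longrightarrow> P i g \<in> zbounded k"
  by (simp add: Pop_def zbounded_mulx zbounded_dxa mpol.subspace_neg[OF zbounded_subspace])

text \<open>For nonzero a, D may raise the total degree, so only the exponent of x_z can be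
  controlled; x_z enters D solely through x_z d_z.\<close>

lemma zbounded_D: "g \<in> zbounded k \<Longrightarrow> D g \<in> zbounded k"
  unfolding Dop_def
proof (rule mpol.subspace_sum[OF zbounded_subspace])
  fix s assume "g \<in> zbounded k" "s \<in> {1..n}"
  thus "X s (P s g) \<in> zbounded k"
    by (cases "s = z") (auto simp: Xz Pz zbounded_mulx_pdx zbounded_X zbounded_P simp del: One_nat_def)
qed

text \<open>In the raising operator for \<open>d v\<close> the term \<open>X (d v)\<close> after D +
  c stays in \<open>zbounded k\<close>, which leaves x_z \<open>P v g\<close> in W. Because
  \<open>P v\<close> is d_v + a_v, induction on the exponent of x_v removes
  \<open>P v\<close>.\<close>

lemma zbounded_step:
  assumes k: "zbounded k \<subseteq> W"
  shows "zbounded (Suc k) \<subseteq> W"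
proof -
  have *: "mulx z (P v g) \<in> W" if g: "g \<in> zbounded k" for g
  proof -
    have "D g + c \<cdot> g \<in> zbounded k"
      using mpol.subspace_add[OF zbounded_subspace zbounded_D[OF g] mpol.subspace_scale[OF zbounded_subspace g]] .
    hence "X (d v) (D g + c \<cdot> g) \<in> W"
      using k zbounded_X[OF _ d_I[OF vI]] by blast
    moreover have "X (d v) (D g + c \<cdot> g) + \<epsilon> (d v) \<cdot> X z (P (d (d v)) g) \<in> W"
      using W_raise[OF d_I[OF vI]] g k by blast
    ultimately have "\<epsilon> (d v) \<cdot> X z (P v g) \<in> W"
      using W_diff d_d[OF vI] by fastforce
    moreover have "\<epsilon> (d v) \<noteq> 0" by (simp add: eps_def)
    ultimately have "X z (P v g) \<in> W" using W_scale_iff by blast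
    thus ?thesis unfolding Xz .
  qed
  have **: "mulx z (mon \<beta>) \<in> W" if "Poly_Mapping.keys \<beta> \<subseteq> {1..n}" "coef \<beta> z \<le> k" for \<beta>
    using that
  proof (induction "coef \<beta> v" arbitrary: \<beta>)
    case 0
    have "mon \<beta> \<in> zbounded k" using 0 by (simp add: zbounded_def)
    from *[OF this] show ?case using 0(1) av
      by (simp add: P_notin vS pdx_mon mulx_add mulx_psmult W_scale_iff)
  next
    case (Suc l)
    have "mulx z (mon (\<beta> - \<e> v)) \<in> W"
      using Suc keys_diff_exp[of \<beta> "\<e> v"] by (intro Suc(1)) (auto simp: lookup_minus)
    moreover have "mon \<beta> \<in> zbounded k" using Suc by (simp add: zbounded_def)
    from *[OF this]
    have "of_nat (coef \<beta> v) \<cdot> mulx z (mon (\<beta> - \<e> v)) + a v \<cdot> mulx z (mon \<beta>) \<in> W"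
      by (simp add: P_notin vS pdx_mon mulx_add mulx_psmult)
    ultimately have "a v \<cdot> mulx z (mon \<beta>) \<in> W"
      using W_diff W_scale by (metis add_diff_cancel_left')
    thus ?case using av W_scale_iff by blast
  qed
  show ?thesis
  proof
    fix f assume f: "f \<in> zbounded (Suc k)"
    show "f \<in> W"
    proof (rule poly_in_subspace[OF W_subspace])
      fix \<alpha> assume "\<alpha> \<in> Poly_Mapping.keys f"
      hence \<alpha>: "Poly_Mapping.keys \<alpha> \<subseteq> {1..n}" "coef \<alpha> z \<le> Suc k"
        using f by (auto simp: zbounded_def polys_def)
      show "mon \<alpha> \<in> W"
      proof (cases "coef \<alpha> z = 0")
        case True
        hence "mon \<alpha> \<in> zbounded k" using \<alpha> by (simp add: zbounded_def)
        thus ?thesis using k by blast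
      next
        case False
        have "mulx z (mon (\<alpha> - \<e> z)) \<in> W"
          using \<alpha> keys_diff_exp[of \<alpha> "\<e> z"] by (intro **) (auto simp: lookup_minus)
        thus ?thesis using unit_exp_le[OF False] by (simp add: mulx_mon)
      qed
    qed
  qed
qed

lemma irreducible:
  assumes "W \<noteq> {0}"
  shows "W = polys n"
proof
  have z0: "zfree k \<subseteq> W" for k using zfree_subset one_in_W[OF assms] by blast
  have "zbounded k \<subseteq> W" for k
  proof (induction k)
    case 0
    show ?case
    proof
      fix f assume f: "f \<in> zbounded 0"
      show "f \<in> W"
      proof (rule poly_in_subspace[OF W_subspace])
        fix \<alpha> assume "\<alpha> \<in> Poly_Mapping.keys f"
        \<comment> \<open>The space has no common degree bound, so each monomial uses the level of
          its own degree.\<close>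
        hence "mon \<alpha> \<in> zfree (deg n \<alpha>)" using f by (auto simp: zbounded_def zfree_def polys_def)
        thus "mon \<alpha> \<in> W" using z0 by blast
      qed
    qed
  qed (use zbounded_step in auto)
  moreover have "mon \<alpha> \<in> zbounded (coef \<alpha> z)" if "Poly_Mapping.keys \<alpha> \<subseteq> {1..n}" for \<alpha>
    using that by (simp add: zbounded_def)
  ultimately show "polys n \<subseteq> W" using polys_subset[OF W_subspace] by blast
qed (use W_polys in auto)

end

section \<open>Composition series\<close>

definition low_polys :: "nat \<Rightarrow> nat \<Rightarrow> ('a::comm_ring_1) mpol set" where
  "low_polys n k = {f \<in> polys n. \<forall>\<alpha>\<in>Poly_Mapping.keys f. deg n \<alpha> \<le> k}"

lemma low_polys_subspace: "mpol.subspace (low_polys n k)"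
proof -
  have "(low_polys n k :: 'a mpol set) = {f. Poly_Mapping.keys f \<subseteq> {\<alpha>. Poly_Mapping.keys \<alpha> \<subseteq> {1..n} \<and> deg n \<alpha> \<le> k}}"
    unfolding low_polys_def polys_def by blast
  thus ?thesis by (simp only: keys_subset_subspace)
qed

lemma low_polys_pdx: "f \<in> low_polys n k \<Longrightarrow> i \<in> {1..n} \<Longrightarrow> pdx i f \<in> low_polys n k"
  by (fastforce simp: low_polys_def pdx_polys wt_add dest!: keys_pdx)

lemma wt_minus_unit:
  assumes "coef \<alpha> i \<noteq> 0" "i \<in> {1..n}"
  shows "wt w n \<alpha> = wt w n (\<alpha> - \<e> i) + w i"
  using wt_add[of w n "\<alpha> - \<e> i" "\<e> i"] unit_exp_le[OF assms(1)] assms(2) by simp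

lemma low_polys_mulx_pdx:
  assumes "f \<in> low_polys n k" "i \<in> {1..n}" "j \<in> {1..n}"
  shows "mulx i (pdx j f) \<in> low_polys n k"
proof -
  have "deg n \<beta> \<le> k" if "\<beta> \<in> Poly_Mapping.keys (mulx i (pdx j f))" for \<beta>
  proof -
    have *: "coef \<beta> i \<noteq> 0" "\<beta> - \<e> i + \<e> j \<in> Poly_Mapping.keys f"
      using that keys_mulx keys_pdx by blast+
    hence "deg n (\<beta> - \<e> i + \<e> j) \<le> k" using assms(1) by (auto simp: low_polys_def)
    thus ?thesis using wt_minus_unit[OF *(1) assms(2)] assms(3) by (simp add: wt_add)
  qed
  thus ?thesis using assms by (auto simp: low_polys_def mulx_polys pdx_polys)
qed

lemma low_polys_Dop:
  assumes "f \<in> low_polys n k"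
  shows "Dop n {} (\<lambda>_. 0) f + t \<cdot> f \<in> low_polys n k"
proof -
  have "Dop n {} (\<lambda>_. 0) f + t \<cdot> f \<in> polys n"
    using assms by (intro mpol.subspace_add[OF polys_subspace] mpol.subspace_scale[OF polys_subspace]
        Dop_polys) (auto simp: low_polys_def)
  thus ?thesis using assms
    by (auto simp: low_polys_def in_keys_iff lookup_add coef_Dop)
qed

text \<open>D - k annihilates the component of degree k, so multiplication by x_i does not leave the
  space.\<close>

lemma low_polys_Xop_Dop:
  assumes f: "f \<in> low_polys n k" and i: "i \<in> {1..n}"
  shows "mulx i (Dop n {} (\<lambda>_. 0) f + (- of_nat k) \<cdot> f) \<in> low_polys n k"
proof -
  let ?g = "Dop n {} (\<lambda>_. 0) f + (- of_nat k) \<cdot> f"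
  have g: "?g \<in> low_polys n k" using low_polys_Dop f by blast
  have eu: "(\<Sum>s=1..n. euler {} \<beta> s) = int (deg n \<beta>)" for \<beta>
    by (simp add: euler_def wt_def)
  have "deg n \<beta> < k" if "\<beta> \<in> Poly_Mapping.keys ?g" for \<beta>
  proof -
    have "deg n \<beta> \<le> k" using that g by (auto simp: low_polys_def)
    moreover have "deg n \<beta> \<noteq> k"
    proof
      assume "deg n \<beta> = k"
      hence "coef (Dop n {} (\<lambda>_. 0) f) \<beta> = of_nat k * coef f \<beta>" unfolding coef_Dop eu by simp
      hence "coef ?g \<beta> = 0" by (simp add: lookup_minus)
      thus False using that by (simp only: in_keys_iff) simp
    qed
    ultimately show ?thesis by simp
  qed
  hence "deg n \<beta> \<le> k" if "\<beta> \<in> Poly_Mapping.keys (mulx i ?g)" for \<beta>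
    using keys_mulx[OF that] wt_minus_unit[of \<beta> i n "\<lambda>_. 1"] i by (fastforce simp: Suc_le_eq)
  thus ?thesis using g i by (auto simp: low_polys_def mulx_polys)
qed

text \<open>Each \<open>piE\<close> and \<open>piH\<close> preserves the space separately, so it is
  stable under all of sl(n+1).\<close>

lemma submodule_low_polys: "submodule (piM n (- of_nat k) {} (\<lambda>_. 0)) L (polys n) (low_polys n k)"
proof -
  have E: "piE n (- of_nat k) {} (\<lambda>_. 0) i j f \<in> low_polys n k"
    if "f \<in> low_polys n k" "i \<in> {1..n+1}" "j \<in> {1..n+1} - {i}" for f :: "'a mpol" and i j
    using that low_polys_Xop_Dop[of f n k i] low_polys_mulx_pdx[of f n k i j]
      low_polys_pdx[of f n k j] mpol.subspace_neg[OF low_polys_subspace[of n k]]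
    by (auto simp: piE_def Xop_def Pop_def dxa_def)
  have H: "piH n (- of_nat k) {} (\<lambda>_. 0) i f \<in> low_polys n k"
    if "f \<in> low_polys n k" "i \<in> {1..n}" for f :: "'a mpol" and i
    using that mpol.subspace_add[OF low_polys_subspace[of n k]
        low_polys_mulx_pdx[of f n k i i] low_polys_Dop[of f n k "- of_nat k"]]
    by (simp add: piH_def Xop_def Pop_def dxa_def add_ac)
  have "piM n (- of_nat k) {} (\<lambda>_. 0) M f \<in> low_polys n k" if "f \<in> low_polys n k" for M and f :: "'a mpol"
    unfolding piM_def
    by (intro mpol.subspace_add[OF low_polys_subspace] mpol.subspace_sum[OF low_polys_subspace]
        mpol.subspace_scale[OF low_polys_subspace] E H that) auto
  thus ?thesis
    by (auto simp: submodule_def lin_subspace_iff low_polys_subspace) (simp add: low_polys_def)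
qed

lemma one_low_polys: "1 \<in> low_polys n k"
  by (simp add: low_polys_def polys_def)

lemma low_polys_proper: "n \<ge> 1 \<Longrightarrow> low_polys n k \<noteq> (polys n :: ('a::comm_ring_1) mpol set)"
proof
  assume n: "n \<ge> 1" and eq: "low_polys n k = (polys n :: 'a mpol set)"
  let ?\<alpha> = "Poly_Mapping.single 1 (Suc k) :: nat \<Rightarrow>\<^sub>0 nat"
  have "(mon ?\<alpha> :: 'a mpol) \<in> polys n" using n by simp
  hence "(mon ?\<alpha> :: 'a mpol) \<in> low_polys n k" using eq by simp
  hence "deg n ?\<alpha> \<le> k" by (simp add: low_polys_def)
  moreover have "deg n ?\<alpha> \<ge> coef ?\<alpha> 1"
    unfolding wt_def mult_1 using n by (intro member_le_sum) auto
  ultimately show False by simp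
qed

lemma mulx_pdx_mon: "mulx i (pdx j (mon \<beta>)) = of_nat (coef \<beta> j) \<cdot> mon (\<beta> - \<e> j + \<e> i)"
  by (simp add: pdx_mon mulx_psmult mulx_mon)

lemma unit_exp_swap: "i \<noteq> j \<Longrightarrow> coef \<alpha> i \<noteq> 0 \<Longrightarrow> \<alpha> - \<e> i + \<e> j - \<e> j + \<e> i = \<alpha>"
  by (simp add: unit_exp_le)

section \<open>Finding the lowest weight vector above \<open>low_polys\<close>\<close>

context sp_submodule_std
begin

text \<open>The first factor c + j to vanish is the one at j = k, and it is needed only for reaching
  degree k + 1.\<close>

lemma low_polys_subset:
  assumes "1 \<in> W" "c = - of_nat k"
  shows "low_polys n k \<subseteq> W"
proof
  fix f :: "'a mpol" assume f: "f \<in> low_polys n k"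
  show "f \<in> W"
  proof (rule poly_in_subspace[OF W_subspace], rule mon_from_one)
    fix \<alpha> assume \<alpha>: "\<alpha> \<in> Poly_Mapping.keys f"
    show "Poly_Mapping.keys \<alpha> \<subseteq> {1..n}" using f \<alpha> by (auto simp: low_polys_def polys_def)
    fix j assume "j < deg n \<alpha>"
    hence "j < k" using f \<alpha> by (auto simp: low_polys_def)
    thus "c + of_nat j \<noteq> 0" using assms(2) by simp
  qed (use assms in auto)
qed

lemma one_in: "1 \<in> I"
  using m n by auto

text \<open>The weights make \<open>P\<^sub>z\<close>, the lowering operators and the operators \<open>X\<^sub>1 P\<^sub>j \<plusminus> \<dots>\<close> strictly
  decreasing, so a minimal element modulo \<open>low_polys n k\<close> is a lowest weight vector.\<close>

lemma extremal_in_W: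
  assumes low: "low_polys n k \<subseteq> W" and ne: "W \<noteq> low_polys n k"
  shows "mon (Poly_Mapping.single 1 (Suc k)) \<in> W"
proof -
  \<comment> \<open>Every term has to lose weight: X_1 P_1' loses 3 - 1, X_1 P_j and X_j' P_1' lose
    2 - 1 and 3 - 2, P_1 and X_1' P_z lose 1 and 4 - 3.\<close>
  define w where "w = (\<lambda>i::nat. if i = z then 4 else if i = 1 then 1 else if i = d 1 then 3 else 2 :: nat)"
  \<comment> \<open>The part of degree above k; it lies in W together with g since the remainder
    lies in \<open>low_polys n k\<close>. Truncation thus stands in for the quotient.\<close>
  define hi where "hi = (\<lambda>g :: 'a mpol. \<Sum>\<alpha>\<in>{\<alpha>\<in>Poly_Mapping.keys g. deg n \<alpha> > k}. Poly_Mapping.single \<alpha> (coef g \<alpha>))"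
  have hi: "coef (hi g) \<alpha> = (if deg n \<alpha> > k then coef g \<alpha> else 0)" for g \<alpha>
    unfolding hi_def by (subst coef_sum_single) (auto simp: in_keys_iff)
  have hiW: "hi g \<in> W" if "g \<in> W" for g
  proof -
    have "Poly_Mapping.keys (g - hi g) \<subseteq> {\<alpha> \<in> Poly_Mapping.keys g. deg n \<alpha> \<le> k}"
      by (auto simp: in_keys_iff lookup_minus hi split: if_splits)
    hence "g - hi g \<in> low_polys n k"
      using W_polys[OF that] unfolding low_polys_def polys_def by blast
    hence "g - (g - hi g) \<in> W" using low that W_diff by blast
    thus ?thesis by simp
  qed
  define Q where "Q = {g \<in> W. \<forall>\<alpha>. coef g \<alpha> \<noteq> 0 \<longrightarrow> deg n \<alpha> > k}"
  obtain f0 where f0: "f0 \<in> W" "f0 \<notin> low_polys n k" using low ne by blast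
  have "hi f0 \<noteq> 0"
  proof
    assume "hi f0 = 0"
    hence "\<not> deg n \<alpha> > k" if "coef f0 \<alpha> \<noteq> 0" for \<alpha> using hi[of f0 \<alpha>] that by auto
    thus False using f0 W_polys by (auto simp: low_polys_def in_keys_iff not_less)
  qed
  moreover have "hi f0 \<in> Q" using hiW f0 by (auto simp: Q_def hi)
  ultimately obtain f where f: "f \<in> Q" "f \<noteq> 0" and min: "\<And>g. g \<in> Q \<Longrightarrow>
     (\<And>\<beta>. \<beta> \<in> Poly_Mapping.keys g \<Longrightarrow> \<exists>\<alpha>\<in>Poly_Mapping.keys f. wt w n \<beta> < wt w n \<alpha>) \<Longrightarrow> g = 0"
    using minimal_weight[where w = "wt w n"] by metis
  have fW: "f \<in> W" and fk: "\<And>\<alpha>. coef f \<alpha> \<noteq> 0 \<Longrightarrow> deg n \<alpha> > k" using f by (auto simp: Q_def)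
  have keyI: "1 \<in> {1..n}" "d 1 \<in> {1..n}" "1 \<noteq> z" "d 1 \<noteq> z" "d 1 \<noteq> 1"
    using m n by (auto simp: dual_def)
  \<comment> \<open>An element of W of smaller weight than f has zero truncation by minimality, so
    its coefficients above degree k vanish.\<close>
  have killed: "coef g \<beta> = 0"
    if g: "g \<in> W" and dec: "\<And>\<beta>. coef g \<beta> \<noteq> 0 \<Longrightarrow> \<exists>\<alpha>. coef f \<alpha> \<noteq> 0 \<and> wt w n \<beta> < wt w n \<alpha>"
      and \<beta>: "deg n \<beta> > k" for g \<beta>
  proof -
    have "hi g = 0"
    proof (rule min)
      show "hi g \<in> Q" using hiW[OF g] by (simp add: Q_def hi)
      fix \<gamma> assume "\<gamma> \<in> Poly_Mapping.keys (hi g)"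
      hence "coef g \<gamma> \<noteq> 0" by (auto simp: in_keys_iff hi split: if_splits)
      thus "\<exists>\<alpha>\<in>Poly_Mapping.keys f. wt w n \<gamma> < wt w n \<alpha>"
        using dec unfolding Bex_def in_keys_iff by blast
    qed
    thus ?thesis using hi[of g \<beta>] \<beta> by simp
  qed
  have wt_swap: "wt w n (\<beta> - \<e> i + \<e> j) > wt w n \<beta>"
    if "coef \<beta> i \<noteq> 0" "i \<in> {1..n}" "j \<in> {1..n}" "w i < w j" for \<beta> i j
    using wt_minus_unit[of \<beta> i n w] that by (simp add: wt_add)
  \<comment> \<open>X_1 P_1' f vanishes above degree k. Its coefficient at \<alpha> with one x_1'
    replaced by x_1 is a positive integer times the coefficient of f at \<alpha>.\<close>
  have no_d1: "coef f \<alpha> = 0" if "coef \<alpha> (d 1) \<noteq> 0" for \<alpha>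
  proof (rule ccontr)
    assume nz: "coef f \<alpha> \<noteq> 0"
    let ?g = "mulx 1 (pdx (d 1) f)" and ?\<beta> = "\<alpha> - \<e> (d 1) + \<e> 1"
    have "?g \<in> W" using W_long[OF d_I[OF one_in] fW] unfolding d_d[OF one_in] X_mulx P_pdx .
    moreover have "\<exists>\<alpha>. coef f \<alpha> \<noteq> 0 \<and> wt w n \<beta> < wt w n \<alpha>" if "coef ?g \<beta> \<noteq> 0" for \<beta>
    proof -
      have \<beta>: "coef \<beta> 1 \<noteq> 0" "coef f (\<beta> - \<e> 1 + \<e> (d 1)) \<noteq> 0"
        using that by (auto simp: coef_mulx coef_pdx simp del: One_nat_def split: if_splits)
      have "w 1 < w (d 1)" using keyI(3-5) by (simp add: w_def del: One_nat_def)
      from wt_swap[OF \<beta>(1) keyI(1,2) this] show ?thesis using \<beta>(2) by blast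
    qed
    moreover have "deg n ?\<beta> > k"
      using fk[OF nz] wt_minus_unit[OF that keyI(2), of "\<lambda>_. 1"] keyI(1) by (simp add: wt_add del: One_nat_def)
    ultimately have "coef ?g ?\<beta> = 0" by (rule killed)
    moreover have "(of_nat i + 1 :: 'a) \<noteq> 0" for i
      using of_nat_neq_0[of i, where 'a = 'a] by (simp add: add.commute)
    ultimately show False using nz keyI unit_exp_swap[of "d 1" 1 \<alpha>] that
      by (auto simp: coef_mulx coef_pdx lookup_add simp del: One_nat_def of_nat_Suc simp flip: of_nat_Suc)
  qed
  \<comment> \<open>The same replacement for x_j; the second term of the quadratic operator
    contributes nothing because x_1' no longer occurs in f.\<close>
  have no_j: "coef f \<alpha> = 0" if j: "j \<in> I" "j \<noteq> 1" "coef \<alpha> j \<noteq> 0" for j \<alpha>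
  proof (rule ccontr)
    assume nz: "coef f \<alpha> \<noteq> 0"
    have jd: "j \<noteq> d 1" using no_d1 nz j by blast
    have dj: "d j \<in> {1..n}" "d j \<noteq> z" "d j \<noteq> 1" "d j \<noteq> d 1" "j \<in> {1..n}" "j \<noteq> z"
      using d_I[OF j(1)] d_d[OF j(1)] d_d[OF one_in] jd j by auto
    let ?g = "mulx 1 (pdx j f) - (\<epsilon> 1 * \<epsilon> j) \<cdot> mulx (d j) (pdx (d 1) f)"
    let ?\<beta> = "\<alpha> - \<e> j + \<e> 1"
    have "?g \<in> W" using W_quad[OF one_in j(1) fW] by (simp add: X_mulx P_pdx)
    moreover have "\<exists>\<alpha>. coef f \<alpha> \<noteq> 0 \<and> wt w n \<beta> < wt w n \<alpha>" if g: "coef ?g \<beta> \<noteq> 0" for \<beta>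
    proof -
      have "coef (mulx 1 (pdx j f)) \<beta> \<noteq> 0 \<or> coef (mulx (d j) (pdx (d 1) f)) \<beta> \<noteq> 0"
        using g by (auto simp: lookup_minus)
      hence "coef \<beta> 1 \<noteq> 0 \<and> coef f (\<beta> - \<e> 1 + \<e> j) \<noteq> 0
         \<or> coef \<beta> (d j) \<noteq> 0 \<and> coef f (\<beta> - \<e> (d j) + \<e> (d 1)) \<noteq> 0"
        by (auto simp: coef_mulx coef_pdx simp del: One_nat_def split: if_splits)
      thus ?thesis
      proof
        assume "coef \<beta> 1 \<noteq> 0 \<and> coef f (\<beta> - \<e> 1 + \<e> j) \<noteq> 0"
        thus ?thesis using keyI dj j jd
          by (intro exI[of _ "\<beta> - \<e> 1 + \<e> j"] conjI wt_swap) (auto simp: w_def simp del: One_nat_def)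
      next
        assume "coef \<beta> (d j) \<noteq> 0 \<and> coef f (\<beta> - \<e> (d j) + \<e> (d 1)) \<noteq> 0"
        thus ?thesis using keyI dj j jd
          by (intro exI[of _ "\<beta> - \<e> (d j) + \<e> (d 1)"] conjI wt_swap) (auto simp: w_def simp del: One_nat_def)
      qed
    qed
    moreover have "deg n ?\<beta> > k"
      using fk[OF nz] wt_minus_unit[OF j(3) dj(5), of "\<lambda>_. 1"] keyI(1) by (simp add: wt_add del: One_nat_def)
    ultimately have "coef ?g ?\<beta> = 0" by (rule killed)
    moreover have "coef (mulx (d j) (pdx (d 1) f)) ?\<beta> = 0"
      by (simp add: coef_mulx coef_pdx no_d1 lookup_add)
    ultimately show False using nz j unit_exp_swap[of j 1 \<alpha>]
      by (auto simp: coef_mulx coef_pdx lookup_add lookup_minus simp del: One_nat_def of_nat_Suc simp flip: of_nat_Suc)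
  qed
  \<comment> \<open>P_z costs one degree, and its result is visible only above degree k. Monomials
    of degree exactly k + 1 containing x_z therefore survive this step.\<close>
  have no_z2: "coef f \<alpha> = 0" if "coef \<alpha> z \<noteq> 0" "deg n \<alpha> > Suc k" for \<alpha>
  proof -
    have "pdx z f \<in> W" using W_Pz[OF fW] by (simp add: P_pdx)
    moreover have "\<exists>\<alpha>. coef f \<alpha> \<noteq> 0 \<and> wt w n \<beta> < wt w n \<alpha>" if "coef (pdx z f) \<beta> \<noteq> 0" for \<beta>
      using that z_in by (intro exI[of _ "\<beta> + \<e> z"]) (auto simp: coef_pdx wt_add w_def)
    moreover have "deg n (\<alpha> - \<e> z) > k"
      using that wt_minus_unit[OF that(1) z_in, of "\<lambda>_. 1"] by simp
    ultimately have "coef (pdx z f) (\<alpha> - \<e> z) = 0" by (rule killed)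
    thus ?thesis using unit_exp_le[OF that(1)]
      by (auto simp: coef_pdx simp del: of_nat_Suc simp flip: of_nat_Suc)
  qed
  \<comment> \<open>Comparison of coefficients in P_1 f - X_1' P_z f, which vanishes above degree
    k.\<close>
  have lower: "of_nat (coef \<beta> 1 + 1) * coef f (\<beta> + \<e> 1)
      = (if coef \<beta> (d 1) = 0 then 0 else of_nat (coef (\<beta> - \<e> (d 1)) z + 1) * coef f (\<beta> - \<e> (d 1) + \<e> z))"
    if "deg n \<beta> > k" for \<beta>
  proof -
    let ?g = "pdx 1 f - \<epsilon> 1 \<cdot> mulx (d 1) (pdx z f)"
    have "?g \<in> W" using W_lower[OF one_in fW] by (simp add: X_mulx P_pdx)
    moreover have "\<exists>\<alpha>. coef f \<alpha> \<noteq> 0 \<and> wt w n \<beta> < wt w n \<alpha>" if g: "coef ?g \<beta> \<noteq> 0" for \<beta>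
    proof -
      have "coef (pdx 1 f) \<beta> \<noteq> 0 \<or> coef (mulx (d 1) (pdx z f)) \<beta> \<noteq> 0"
        using g by (auto simp: lookup_minus)
      hence "coef f (\<beta> + \<e> 1) \<noteq> 0 \<or> coef \<beta> (d 1) \<noteq> 0 \<and> coef f (\<beta> - \<e> (d 1) + \<e> z) \<noteq> 0"
        by (auto simp: coef_mulx coef_pdx simp del: One_nat_def split: if_splits)
      thus ?thesis
      proof
        assume "coef f (\<beta> + \<e> 1) \<noteq> 0"
        thus ?thesis using keyI by (intro exI[of _ "\<beta> + \<e> 1"]) (auto simp: wt_add w_def simp del: One_nat_def)
      next
        assume "coef \<beta> (d 1) \<noteq> 0 \<and> coef f (\<beta> - \<e> (d 1) + \<e> z) \<noteq> 0"
        thus ?thesis using keyI z_in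
          by (intro exI[of _ "\<beta> - \<e> (d 1) + \<e> z"] conjI wt_swap) (auto simp: w_def simp del: One_nat_def)
      qed
    qed
    ultimately have "coef ?g \<beta> = 0" using that by (rule killed)
    thus ?thesis by (simp add: lookup_minus coef_mulx coef_pdx eps_def split: if_splits)
  qed
  have only: "\<alpha> = Poly_Mapping.single 1 (Suc k)" if nz: "coef f \<alpha> \<noteq> 0" for \<alpha>
  proof -
    have keys: "Poly_Mapping.keys \<alpha> \<subseteq> {1..n}"
      using W_polys[OF fW] nz by (auto simp: polys_def in_keys_iff)
    \<comment> \<open>The surviving monomials of degree k + 1 are excluded by trading x_z for x_1'
      in \<open>lower\<close>: the left side then involves x_1' and is 0.\<close>
    have z0: "coef \<alpha> z = 0"
    proof (rule ccontr)
      assume z: "coef \<alpha> z \<noteq> 0"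
      hence deg: "deg n \<alpha> = Suc k" using no_z2 nz fk[OF nz] by fastforce
      let ?\<beta> = "\<alpha> - \<e> z + \<e> (d 1)"
      have "deg n ?\<beta> > k" using wt_minus_unit[OF z z_in, of "\<lambda>_. 1"] deg keyI by (simp add: wt_add)
      moreover have "coef f (?\<beta> + \<e> 1) = 0" by (rule no_d1) (simp add: lookup_add)
      moreover have "?\<beta> - \<e> (d 1) + \<e> z = \<alpha>" using unit_exp_swap[OF _ z, of "d 1"] keyI by simp
      ultimately show False using lower[of ?\<beta>] nz
        by (auto simp: lookup_add simp del: of_nat_Suc simp flip: of_nat_Suc)
    qed
    have eq: "\<alpha> = Poly_Mapping.single 1 (coef \<alpha> 1)"
    proof (rule poly_mapping_eqI)
      fix j
      have "coef \<alpha> j = 0" if "j \<noteq> 1"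
      proof (cases "j \<in> I")
        case True
        thus ?thesis using no_j nz that by blast
      next
        case False
        thus ?thesis using z0 keys by (cases "j = z") (auto simp: in_keys_iff subset_iff)
      qed
      thus "coef \<alpha> j = coef (Poly_Mapping.single 1 (coef \<alpha> 1)) j"
        by (cases "j = 1") (auto simp: lookup_single)
    qed
    have deg1: "deg n \<alpha> = coef \<alpha> 1"
    proof -
      have "deg n \<alpha> = (\<Sum>i=1..n. if i = 1 then coef \<alpha> 1 else 0)"
        unfolding wt_def by (subst eq) (auto simp: lookup_single when_def intro!: sum.cong)
      thus ?thesis using keyI(1) by simp
    qed
    have nz1: "coef \<alpha> 1 \<noteq> 0" using fk[OF nz] deg1 by simp
    \<comment> \<open>Only powers of x_1 remain. If the exponent exceeded k + 1,
      \<open>lower\<close> at one power less would force the coefficient to be 0, its right side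
      having no x_1'.\<close>
    have "\<not> deg n \<alpha> > Suc k"
    proof
      assume "deg n \<alpha> > Suc k"
      hence "deg n (\<alpha> - \<e> 1) > k" using wt_minus_unit[OF nz1 keyI(1), of "\<lambda>_. 1"] by simp
      moreover have "coef (\<alpha> - \<e> 1) (d 1) = 0"
        using keyI by (subst eq) (simp add: lookup_minus lookup_single)
      ultimately have "coef f (\<alpha> - \<e> 1 + \<e> 1) = 0" using lower[of "\<alpha> - \<e> 1"]
        by (auto simp del: of_nat_Suc simp flip: of_nat_Suc)
      thus False using nz unit_exp_le[OF nz1] by simp
    qed
    thus ?thesis using eq deg1 fk[OF nz] by (metis Suc_lessI)
  qed
  let ?\<alpha> = "Poly_Mapping.single 1 (Suc k) :: nat \<Rightarrow>\<^sub>0 nat"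
  have "f = coef f ?\<alpha> \<cdot> mon ?\<alpha>"
    by (rule poly_mapping_eqI) (use only in \<open>auto simp: lookup_single when_def\<close>)
  moreover from this have "coef f ?\<alpha> \<noteq> 0" using f(2) by (metis mpol.scale_zero_left)
  ultimately show ?thesis using fW W_scale_iff by metis
qed

end

section \<open>From the lowest weight vector to the whole space\<close>

context sp_submodule_std
begin

text \<open>The forms of degree k in the 2m variables other than x_z are a symmetric power of the
  natural sp(2m)-module, generated by x_1^k. The outer induction counts factors other than x_1 and
  x_1', the inner one the exponent of x_1'.\<close>

lemma zfree_degree_in_W:
  assumes ext: "mon (Poly_Mapping.single 1 k) \<in> W"
    and \<alpha>: "Poly_Mapping.keys \<alpha> \<subseteq> {1..n}" "coef \<alpha> z = 0" "deg n \<alpha> = k"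
  shows "mon \<alpha> \<in> W"
proof -
  define w where "w = (\<lambda>i::nat. if i = z \<or> i = 1 \<or> i = d 1 then 0 else 1 :: nat)"
  have keyI: "1 \<in> {1..n}" "d 1 \<in> {1..n}" "1 \<noteq> z" "d 1 \<noteq> z" "d 1 \<noteq> 1"
    using m n by (auto simp: dual_def)
  have keys_swap: "Poly_Mapping.keys (\<alpha> - \<e> i + \<e> j) \<subseteq> {1..n}"
    if "Poly_Mapping.keys \<alpha> \<subseteq> {1..n}" "j \<in> {1..n}" for \<alpha> i j
    using that keys_add[of "\<alpha> - \<e> i" "\<e> j"] keys_diff_exp[of \<alpha> "\<e> i"] by fastforce
  have wt_swap: "wt u n (\<alpha> - \<e> i + \<e> j) + u i = wt u n \<alpha> + u j"
    if "coef \<alpha> i \<noteq> 0" "i \<in> {1..n}" "j \<in> {1..n}" for u \<alpha> i j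
    using wt_minus_unit[OF that(1,2), of u] that by (simp add: wt_add)
  show ?thesis using \<alpha>
  proof (induction "wt w n \<alpha>" arbitrary: \<alpha> rule: less_induct)
    case outer: less
    \<comment> \<open>The outer hypothesis is put back into the goal because the inner induction
      changes \<alpha> while keeping its weight.\<close>
    show ?case using outer(2-4) outer(1)
    proof (induction "coef \<alpha> (d 1)" arbitrary: \<alpha>)
      case (Suc b)
      let ?\<beta> = "\<alpha> - \<e> (d 1) + \<e> 1"
      have nz: "coef \<alpha> (d 1) \<noteq> 0" using Suc(2) by simp
      have "mon ?\<beta> \<in> W"
      proof (rule Suc(1))
        show "b = coef ?\<beta> (d 1)" using Suc(2) keyI by (simp add: lookup_add lookup_minus lookup_single)
        show "coef ?\<beta> z = 0" using Suc(4) keyI by (simp add: lookup_add lookup_minus lookup_single)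
        show "deg n ?\<beta> = k" using wt_swap[OF nz keyI(2,1), of "\<lambda>_. 1"] Suc(5) by simp
        have "wt w n ?\<beta> = wt w n \<alpha>" using wt_swap[OF nz keyI(2,1), of w] by (simp add: w_def)
        thus "mon \<gamma> \<in> W" if "wt w n \<gamma> < wt w n ?\<beta>" "Poly_Mapping.keys \<gamma> \<subseteq> {1..n}" "coef \<gamma> z = 0"
          "deg n \<gamma> = k" for \<gamma> using that Suc(6) by simp
      qed (use Suc keys_swap keyI in simp)
      from W_long[OF one_in this] have "of_nat (coef ?\<beta> 1) \<cdot> mon (?\<beta> - \<e> 1 + \<e> (d 1)) \<in> W"
        by (simp add: X_mulx P_pdx mulx_pdx_mon)
      moreover have "coef ?\<beta> 1 \<noteq> 0" by (simp add: lookup_add)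
      ultimately show ?case using unit_exp_swap[OF _ nz, of 1] keyI
        by (metis W_scale_iff of_nat_eq_0_iff)
    next
      case 0
      show ?case
      proof (cases "\<exists>j\<in>I. j \<noteq> 1 \<and> coef \<alpha> j \<noteq> 0")
        case True
        then obtain j where j: "j \<in> I" "j \<noteq> 1" "coef \<alpha> j \<noteq> 0" by blast
        have jd: "j \<noteq> d 1" using 0(1) j by auto
        have dj: "d j \<in> {1..n}" "d j \<noteq> z" "d j \<noteq> 1" "d j \<noteq> d 1" "j \<in> {1..n}" "j \<noteq> z"
          using d_I[OF j(1)] d_d[OF j(1)] d_d[OF one_in] jd j by auto
        let ?\<beta> = "\<alpha> - \<e> j + \<e> 1"
        have \<beta>: "Poly_Mapping.keys ?\<beta> \<subseteq> {1..n}" "coef ?\<beta> z = 0" "deg n ?\<beta> = k" "wt w n ?\<beta> < wt w n \<alpha>"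
        proof -
          show "Poly_Mapping.keys ?\<beta> \<subseteq> {1..n}" using keys_swap[OF 0(2) keyI(1)] .
          show "coef ?\<beta> z = 0" using 0(3) keyI(3) by (simp add: lookup_add lookup_minus lookup_single)
          show "deg n ?\<beta> = k" using wt_swap[OF j(3) dj(5) keyI(1), of "\<lambda>_. 1"] 0(4) by simp
          have "w j = 1" "w 1 = 0" using jd j(2) dj(6) by (simp_all add: w_def)
          thus "wt w n ?\<beta> < wt w n \<alpha>" using wt_swap[OF j(3) dj(5) keyI(1), of w] by simp
        qed
        hence \<beta>W: "mon ?\<beta> \<in> W" using 0 by blast
        \<comment> \<open>The correction has more factors x_1' but strictly smaller weight than
          \<alpha>, so the outer hypothesis covers it.\<close>
        have 2: "mulx (d 1) (pdx (d j) (mon ?\<beta>)) \<in> W"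
        proof (cases "coef ?\<beta> (d j) = 0")
          case False
          let ?\<gamma> = "?\<beta> - \<e> (d j) + \<e> (d 1)"
          have "Poly_Mapping.keys ?\<gamma> \<subseteq> {1..n}" using \<beta> keyI keys_swap by blast
          moreover have "coef ?\<gamma> z = 0" using \<beta> dj keyI by (simp add: lookup_add lookup_minus lookup_single)
          moreover have "deg n ?\<gamma> = k" using wt_swap[OF False dj(1) keyI(2), of "\<lambda>_. 1"] \<beta>(3) by simp
          moreover have "wt w n ?\<gamma> < wt w n \<alpha>"
            using wt_swap[OF False dj(1) keyI(2), of w] \<beta>(4) by (simp add: w_def)
          ultimately have "mon ?\<gamma> \<in> W" using 0 by blast
          thus ?thesis by (simp only: mulx_pdx_mon W_scale)
        qed (simp add: mulx_pdx_mon)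
        have "mulx j (pdx 1 (mon ?\<beta>)) - (\<epsilon> j * \<epsilon> 1) \<cdot> mulx (d 1) (pdx (d j) (mon ?\<beta>)) \<in> W"
          using W_quad[OF j(1) one_in \<beta>W] by (simp add: X_mulx P_pdx)
        from W_add[OF this W_scale[OF 2]] have "mulx j (pdx 1 (mon ?\<beta>)) \<in> W"
          by (metis diff_add_cancel)
        hence "of_nat (coef ?\<beta> 1) \<cdot> mon (?\<beta> - \<e> 1 + \<e> j) \<in> W" by (simp only: mulx_pdx_mon)
        moreover have "coef ?\<beta> 1 \<noteq> 0" by (simp add: lookup_add)
        ultimately show ?thesis using unit_exp_swap[OF j(2,3)]
          by (metis W_scale_iff of_nat_eq_0_iff)
      next
        case False
        hence no: "coef \<alpha> j = 0" if "j \<noteq> 1" for j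
          using that 0 by (cases "j \<in> I") (auto simp: in_keys_iff subset_iff)
        have "deg n \<alpha> = (\<Sum>i=1..n. if i = 1 then coef \<alpha> 1 else 0)"
          unfolding wt_def by (intro sum.cong refl) (simp add: no)
        hence "coef \<alpha> 1 = k" using keyI(1) 0 by simp
        hence "\<alpha> = Poly_Mapping.single 1 k"
          using no by (intro poly_mapping_eqI) (auto simp: lookup_single when_def)
        thus ?thesis using ext by simp
      qed
    qed
  qed
qed

text \<open>Write x^\<alpha> = h x_z. On degree k + 1 the operator D + c is the identity, so raising
  h x_1' by x_1 and h x_1 by x_1' gives the same monomial h x_1 x_1' of degree k + 2, with
  corrections in x^\<alpha> of opposite sign. The difference is a positive integer multiple of
  x^\<alpha>.\<close>

lemma degree_in_W:
  assumes ck: "c = - of_nat k"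
    and ext: "mon (Poly_Mapping.single 1 (Suc k)) \<in> W"
    and \<alpha>: "Poly_Mapping.keys \<alpha> \<subseteq> {1..n}" "deg n \<alpha> = Suc k"
  shows "mon \<alpha> \<in> W"
  using \<alpha>
proof (induction "coef \<alpha> z" arbitrary: \<alpha>)
  case 0
  thus ?case using zfree_degree_in_W[OF ext] by simp
next
  case (Suc l)
  have keyI: "1 \<in> {1..n}" "d 1 \<in> {1..n}" "1 \<noteq> z" "d 1 \<noteq> z" "d 1 \<noteq> 1"
    using m n by (auto simp: dual_def)
  let ?h = "\<alpha> - \<e> z"
  have nz: "coef \<alpha> z \<noteq> 0" using Suc(2) by simp
  have h: "deg n ?h = k" using wt_minus_unit[OF nz z_in, of "\<lambda>_. 1"] Suc(4) by simp
  have hz: "?h + \<e> z = \<alpha>" by (rule unit_exp_le[OF nz])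
  have in_W: "mon (?h + \<e> j) \<in> W" if "j \<in> {1..n}" "j \<noteq> z" for j
  proof (rule Suc(1))
    show "l = coef (?h + \<e> j) z" using Suc(2) that(2) by (simp add: lookup_add lookup_minus lookup_single)
    show "Poly_Mapping.keys (?h + \<e> j) \<subseteq> {1..n}"
      using Suc(3) that(1) keys_add[of ?h "\<e> j"] keys_diff_exp[of \<alpha> "\<e> z"] by fastforce
    show "deg n (?h + \<e> j) = Suc k" using h that(1) by (simp add: wt_add)
  qed
  have D1: "D (mon (?h + \<e> j)) + c \<cdot> mon (?h + \<e> j) = mon (?h + \<e> j)" if "j \<in> {1..n}" for j
    unfolding D_mon using that h by (simp add: wt_add ck)
  have e1: "\<epsilon> 1 = 1" and ed: "\<epsilon> (d 1) = -1" using m by (auto simp: eps_def dual_def)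
  have "X 1 (D (mon (?h + \<e> (d 1))) + c \<cdot> mon (?h + \<e> (d 1)))
      + \<epsilon> 1 \<cdot> X z (P (d 1) (mon (?h + \<e> (d 1)))) \<in> W"
    by (intro W_raise one_in in_W keyI)
  hence 1: "mon (?h + \<e> (d 1) + \<e> 1) + of_nat (Suc (coef ?h (d 1))) \<cdot> mon \<alpha> \<in> W"
    using hz unfolding D1[OF keyI(2)] e1 X_mulx P_pdx mulx_pdx_mon mulx_mon by (simp add: lookup_add)
  have "X (d 1) (D (mon (?h + \<e> 1)) + c \<cdot> mon (?h + \<e> 1))
      + \<epsilon> (d 1) \<cdot> X z (P (d (d 1)) (mon (?h + \<e> 1))) \<in> W"
    by (intro W_raise d_I one_in in_W keyI)
  hence "mon (?h + \<e> 1 + \<e> (d 1)) + (- 1) \<cdot> of_nat (Suc (coef ?h 1)) \<cdot> mon \<alpha> \<in> W"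
    using hz unfolding D1[OF keyI(1)] ed X_mulx P_pdx mulx_pdx_mon mulx_mon d_d[OF one_in]
    by (simp add: lookup_add)
  hence 2: "mon (?h + \<e> (d 1) + \<e> 1) - of_nat (Suc (coef ?h 1)) \<cdot> mon \<alpha> \<in> W"
    by (simp only: mpol.scale_minus_left mpol.scale_one diff_conv_add_uminus add_ac)
  have "of_nat (Suc (coef ?h (d 1)) + Suc (coef ?h 1)) \<cdot> mon \<alpha> \<in> W"
    using W_diff[OF 1 2] unfolding of_nat_add by (simp only: mpol.scale_left_distrib) simp
  thus ?case by (subst (asm) W_scale_iff) (simp_all del: of_nat_Suc of_nat_add)
qed

lemma above_low_polys:
  assumes ck: "c = - of_nat k" and low: "low_polys n k \<subseteq> W" and ne: "W \<noteq> low_polys n k"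
  shows "W = polys n"
proof
  show "polys n \<subseteq> W"
  proof (rule polys_subset[OF W_subspace])
    fix \<alpha> :: "nat \<Rightarrow>\<^sub>0 nat" assume \<alpha>: "Poly_Mapping.keys \<alpha> \<subseteq> {1..n}"
    show "mon \<alpha> \<in> W"
    proof (cases "deg n \<alpha> \<le> k")
      case True
      hence "mon \<alpha> \<in> low_polys n k" using \<alpha> by (simp add: low_polys_def)
      thus ?thesis using low by blast
    next
      case False
      show ?thesis
      \<comment> \<open>From degree k + 1 on, c + j = j - k is a positive integer, so nothing
        obstructs raising.\<close>
      proof (rule raise_degree_range[where k = "Suc k" and l = "deg n \<alpha>"])
        show "mon \<beta> \<in> W" if "Poly_Mapping.keys \<beta> \<subseteq> {1..n}" "deg n \<beta> = Suc k" for \<beta>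
          using degree_in_W[OF ck extremal_in_W[OF low ne]] that by blast
        show "c + of_nat j \<noteq> 0" if "Suc k \<le> j" for j
          using that ck by auto
      qed (use False \<alpha> in auto)
    qed
  qed
qed (use W_polys in auto)

end

lemma comp_series:
  assumes "m \<ge> 1" "n = 2 * m + 1"
  shows "comp_series_length2 (piM n (- of_nat k :: 'a::field_char_0) {} (\<lambda>_. 0)) (sp m) (polys n)"
  unfolding comp_series_length2_def
proof (intro exI[of _ "low_polys n k"] conjI allI impI)
  have loc: "sp_submodule_std m n (- of_nat k) U"
    if "submodule (piM n (- of_nat k :: 'a) {} (\<lambda>_. 0)) (sp m) (polys n) U" for U
    using assms that by unfold_locales auto
  show "submodule (piM n (- of_nat k :: 'a) {} (\<lambda>_. 0)) (sp m) (polys n) (low_polys n k)"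
    by (rule submodule_low_polys)
  have "(0 :: 'a mpol) \<noteq> 1" by simp
  thus "low_polys n k \<noteq> ({0} :: 'a mpol set)" by (metis one_low_polys singletonD)
  show "low_polys n k \<noteq> (polys n :: 'a mpol set)" using low_polys_proper assms by auto
  fix U :: "'a mpol set"
  assume U: "submodule (piM n (- of_nat k) {} (\<lambda>_. 0)) (sp m) (polys n) U"
  then interpret sp_submodule_std m n "- of_nat k" U by (rule loc)
  show "U = {0} \<or> U = low_polys n k" if "U \<subseteq> low_polys n k"
    using low_polys_subset one_in_W that by blast
  show "U = low_polys n k \<or> U = polys n" if "low_polys n k \<subseteq> U"
    using above_low_polys that by blast
qed

section \<open>Weight modules\<close>

text \<open>A finite set involves finitely many exponents, while the powers of x_1 require
  infinitely many.\<close>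

lemma polys_not_fin_dim:
  assumes "n \<ge> 1"
  shows "\<not> fin_dim (polys n :: 'a::field_char_0 mpol set)"
proof
  assume "fin_dim (polys n :: 'a mpol set)"
  then obtain B :: "'a mpol set" where B: "finite B" "polys n \<subseteq> mpol.span B"
    unfolding fin_dim_iff by blast
  define K where "K = (\<Union>b\<in>B. Poly_Mapping.keys b)"
  have "mpol.span B \<subseteq> {f. Poly_Mapping.keys f \<subseteq> K}"
    by (rule mpol.span_minimal[OF _ keys_subset_subspace]) (auto simp: K_def)
  moreover have "(mon (Poly_Mapping.single 1 k) :: 'a mpol) \<in> polys n" for k
    using assms by simp
  ultimately have "Poly_Mapping.keys (mon (Poly_Mapping.single 1 k) :: 'a mpol) \<subseteq> K" for k
    using B(2) by blast
  hence "range (\<lambda>k. Poly_Mapping.single 1 k :: nat \<Rightarrow>\<^sub>0 nat) \<subseteq> K" by auto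
  moreover have "finite K" using B(1) by (simp add: K_def)
  moreover have "inj (\<lambda>k. Poly_Mapping.single 1 k :: nat \<Rightarrow>\<^sub>0 nat)"
    by (rule inj_single)
  ultimately show False by (metis finite_subset infinite_UNIV_nat finite_imageD)
qed

text \<open>The value at m + 1 has a different shape because the partner n + 1 carries no variable:
  the Cartan element there acts by X_z P_z + D + c.\<close>

definition weight_of :: "nat \<Rightarrow> 'a::comm_ring_1 \<Rightarrow> nat set \<Rightarrow> (nat \<Rightarrow>\<^sub>0 nat) \<Rightarrow> nat \<Rightarrow> 'a" where
  "weight_of m c S \<alpha> i = (if i = m + 1 then of_int (euler S \<alpha> i + (\<Sum>s=1..2*m+1. euler S \<alpha> s)) + c
     else of_int (euler S \<alpha> i - euler S \<alpha> (i + m + 1)))"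

lemma coef_cartan:
  assumes "i \<in> {1..m+1}"
  shows "coef (piM (2*m+1) c S (\<lambda>_. 0) (cartan m i) f) \<alpha> = weight_of m c S \<alpha> i * coef f \<alpha>"
proof -
  have "(cartan m i :: nat \<Rightarrow> nat \<Rightarrow> 'a) = gen m i i"
    using assms by (auto simp: cartan_def gen_def eps_def dual_def fun_eq_iff add_ac)
  hence "piM (2*m+1) c S (\<lambda>_. 0) (cartan m i) f = piM (2*m+1) c S (\<lambda>_. 0) (matE i i) f
      - piM (2*m+1) c S (\<lambda>_. 0) (matE (i+m+1) (i+m+1)) f"
    using assms by (simp add: piM_gen eps_def dual_def)
  also have "\<dots> = (if i = m + 1 then piH (2*m+1) c S (\<lambda>_. 0) i f
      else piH (2*m+1) c S (\<lambda>_. 0) i f - piH (2*m+1) c S (\<lambda>_. 0) (i + m + 1) f)"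
    using assms by (auto simp: piM_matE)
  finally show ?thesis
    by (simp add: weight_of_def piH_def lookup_add lookup_minus coef_Xop_Pop coef_Dop
        distrib_right left_diff_distrib del: sum.cl_ivl_Suc)
qed

lemma weight_space_iff:
  "f \<in> weight_space m (piM (2*m+1) c S (\<lambda>_. 0)) (polys n) \<mu>
     \<longleftrightarrow> f \<in> polys n \<and> (\<forall>\<alpha> i. coef f \<alpha> \<noteq> 0 \<longrightarrow> i \<in> {1..m+1} \<longrightarrow> weight_of m c S \<alpha> i = \<mu> i)"
  for c :: "'a::field_char_0"
proof -
  have "piM (2*m+1) c S (\<lambda>_. 0) (cartan m i) f = \<mu> i \<cdot> f
      \<longleftrightarrow> (\<forall>\<alpha>. coef f \<alpha> \<noteq> 0 \<longrightarrow> weight_of m c S \<alpha> i = \<mu> i)" if "i \<in> {1..m+1}" for i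
    unfolding poly_mapping_eq_iff fun_eq_iff coef_cartan[OF that] by auto
  thus ?thesis unfolding weight_space_def by blast
qed

lemma weight_module_polys:
  "weight_module m (piM (2*m+1) c S (\<lambda>_. 0)) (polys n)" for c :: "'a::field_char_0"
  unfolding weight_module_def
proof
  fix f :: "'a mpol" assume f: "f \<in> polys n"
  define K where "K = Poly_Mapping.keys f"
  \<comment> \<open>Monomials are grouped by the whole function \<open>weight_of\<close>, including
    its values outside the Cartan indices; this may split a weight component further, which a finite
    sum of weight vectors permits.\<close>
  define h where "h = (\<lambda>\<mu>. \<Sum>\<alpha>\<in>{\<alpha>\<in>K. weight_of m c S \<alpha> = \<mu>}. Poly_Mapping.single \<alpha> (coef f \<alpha>))"
  have h: "coef (h \<mu>) \<alpha> = (if weight_of m c S \<alpha> = \<mu> then coef f \<alpha> else 0)" for \<mu> \<alpha>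
    unfolding h_def K_def by (subst coef_sum_single) (auto simp: in_keys_iff)
  show "\<exists>\<Lambda> w. finite \<Lambda> \<and> (\<forall>\<mu>\<in>\<Lambda>. w \<mu> \<in> weight_space m (piM (2*m+1) c S (\<lambda>_. 0)) (polys n) \<mu>)
      \<and> f = (\<Sum>\<mu>\<in>\<Lambda>. w \<mu>)"
  proof (intro exI[of _ "weight_of m c S ` K"] exI[of _ h] conjI ballI)
    show "finite (weight_of m c S ` K)" by (simp add: K_def)
    show "h \<mu> \<in> weight_space m (piM (2*m+1) c S (\<lambda>_. 0)) (polys n) \<mu>" for \<mu>
      using f unfolding weight_space_iff by (auto simp: h polys_def in_keys_iff split: if_splits)
    show "f = (\<Sum>\<mu>\<in>weight_of m c S ` K. h \<mu>)"
      by (rule poly_mapping_eqI) (auto simp: lookup_sum h K_def in_keys_iff)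
  qed
qed

section \<open>Finiteness of the weight spaces\<close>

lemma finite_bounded_exps:
  assumes "finite A"
  shows "finite {\<alpha> :: nat \<Rightarrow>\<^sub>0 nat. Poly_Mapping.keys \<alpha> \<subseteq> A \<and> (\<forall>i. coef \<alpha> i \<le> B)}" (is "finite ?E")
proof (rule finite_imageD)
  have "coef ` ?E \<subseteq> {f. \<forall>i. (i \<in> A \<longrightarrow> f i \<in> {..B}) \<and> (i \<notin> A \<longrightarrow> f i = 0)}"
    by (auto simp: in_keys_iff subset_iff)
  thus "finite (coef ` ?E)"
    by (rule finite_subset) (intro finite_set_of_finite_funs assms finite_atMost)
  show "inj_on coef ?E" by (auto intro!: inj_onI poly_mapping_eqI)
qed

text \<open>If neither of \<open>i\<close>, \<open>i + m + 1\<close> lies in \<open>S\<close>, their joint contribution to the Euler degree is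
  \<open>\<alpha>\<^sub>i + \<alpha>\<^sub>i\<^sub>+\<^sub>m\<^sub>+\<^sub>1\<close>; otherwise the difference of the two Euler eigenvalues already bounds both exponents.\<close>

lemma euler_pair_bound:
  assumes "\<not> (i \<in> S \<and> j \<in> S)"
  shows "int (coef \<alpha> i) + int (coef \<alpha> j)
    \<le> euler S \<alpha> i + euler S \<alpha> j + 2 * \<bar>euler S \<alpha> i - euler S \<alpha> j\<bar> + 2"
  using assms by (auto simp: euler_def)

lemma sum_pairs:
  fixes g :: "nat \<Rightarrow> int"
  shows "(\<Sum>s=1..2*m+1. g s) = g (m + 1) + (\<Sum>i=1..m. g i + g (i + m + 1))"
proof -
  have "{1..2*m+1} = insert (m + 1) ({1..m} \<union> (\<lambda>i. i + m + 1) ` {1..m})"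
  proof
    show "{1..2*m+1} \<subseteq> insert (m + 1) ({1..m} \<union> (\<lambda>i. i + m + 1) ` {1..m})"
    proof
      fix x assume x: "x \<in> {1..2*m+1}"
      show "x \<in> insert (m + 1) ({1..m} \<union> (\<lambda>i. i + m + 1) ` {1..m})"
        using x by (cases "x \<le> m + 1") (auto intro!: image_eqI[of _ _ "x - m - 1"])
    qed
  qed auto
  hence "(\<Sum>s=1..2*m+1. g s) = g (m + 1) + (\<Sum>s\<in>{1..m} \<union> (\<lambda>i. i + m + 1) ` {1..m}. g s)"
    by (simp only:) (subst sum.insert, auto)
  also have "(\<Sum>s\<in>{1..m} \<union> (\<lambda>i. i + m + 1) ` {1..m}. g s)
      = (\<Sum>i=1..m. g i) + (\<Sum>s\<in>(\<lambda>i. i + m + 1) ` {1..m}. g s)"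
    by (rule sum.union_disjoint) auto
  also have "(\<Sum>s\<in>(\<lambda>i. i + m + 1) ` {1..m}. g s) = (\<Sum>i=1..m. g (i + m + 1))"
    by (subst sum.reindex) (auto simp: inj_on_def)
  finally show ?thesis by (simp add: sum.distrib)
qed

text \<open>In characteristic 0 a weight fixes as integers the difference of the Euler eigenvalues
  on each pair and the Euler degree plus \<alpha>_z. Together these bound all exponents; a pair
  contained in S would count negatively and break the estimate.\<close>

lemma weight_space_fin_dim:
  fixes c :: "'a::field_char_0"
  assumes zS: "m + 1 \<notin> S" and S2: "\<forall>i\<in>{1..m}. \<not> (i \<in> S \<and> i + m + 1 \<in> S)"
  shows "fin_dim (weight_space m (piM (2*m+1) c S (\<lambda>_. 0)) (polys (2*m+1)) \<mu>)"
proof -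
  let ?n = "2 * m + 1"
  define A where "A = {\<alpha>. Poly_Mapping.keys \<alpha> \<subseteq> {1..?n} \<and> (\<forall>i\<in>{1..m+1}. weight_of m c S \<alpha> i = \<mu> i)}"
  have "finite A"
  proof (cases "A = {}")
    case False
    then obtain \<alpha>0 where \<alpha>0: "\<alpha>0 \<in> A" by blast
    define t where "t = (\<lambda>\<alpha> i. euler S \<alpha> i - euler S \<alpha> (i + m + 1))"
    define tz where "tz = (\<lambda>\<alpha>. euler S \<alpha> (m + 1) + (\<Sum>s=1..?n. euler S \<alpha> s))"
    \<comment> \<open>Adding \<alpha>_z to the estimates of all pairs gives \<open>tz\<close> -
      \<alpha>_z plus the error terms, which is at most this value.\<close>
    define B where "B = tz \<alpha>0 + (\<Sum>i=1..m. 2 * \<bar>t \<alpha>0 i\<bar> + 2)"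
    have "coef \<alpha> j \<le> nat B" if \<alpha>: "\<alpha> \<in> A" for \<alpha> j
    proof (cases "j \<in> {1..?n}")
      case False
      hence "coef \<alpha> j = 0" using \<alpha> unfolding A_def mem_Collect_eq subset_iff in_keys_iff by blast
      thus ?thesis by simp
    next
      case True
      have t: "t \<alpha> i = t \<alpha>0 i" if "i \<in> {1..m}" for i
      proof -
        have "weight_of m c S \<alpha> i = weight_of m c S \<alpha>0 i" using \<alpha> \<alpha>0 that by (simp add: A_def)
        thus ?thesis using that by (simp add: weight_of_def t_def del: of_int_diff)
      qed
      have "weight_of m c S \<alpha> (m + 1) = weight_of m c S \<alpha>0 (m + 1)" using \<alpha> \<alpha>0 by (simp add: A_def)
      hence tz: "tz \<alpha> = tz \<alpha>0"
        unfolding weight_of_def if_P[OF refl] add_right_cancel of_int_eq_iff tz_def by simp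
      have ez: "euler S \<alpha> (m + 1) = int (coef \<alpha> (m + 1))" using zS by (simp add: euler_def)
      have "int (coef \<alpha> j) \<le> (\<Sum>s=1..?n. int (coef \<alpha> s))"
        using True by (intro member_le_sum) auto
      also have "\<dots> = int (coef \<alpha> (m + 1)) + (\<Sum>i=1..m. int (coef \<alpha> i) + int (coef \<alpha> (i + m + 1)))"
        by (rule sum_pairs)
      also have "(\<Sum>i=1..m. int (coef \<alpha> i) + int (coef \<alpha> (i + m + 1)))
          \<le> (\<Sum>i=1..m. (euler S \<alpha> i + euler S \<alpha> (i + m + 1)) + (2 * \<bar>t \<alpha> i\<bar> + 2))"
        using S2 euler_pair_bound[of _ S _ \<alpha>] unfolding t_def
        by (intro sum_mono) (simp add: add.assoc)
      also have "\<dots> = (\<Sum>i=1..m. euler S \<alpha> i + euler S \<alpha> (i + m + 1)) + (\<Sum>i=1..m. 2 * \<bar>t \<alpha>0 i\<bar> + 2)"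
        unfolding sum.distrib[of "\<lambda>i. euler S \<alpha> i + euler S \<alpha> (i + m + 1)"]
        using t by (intro arg_cong2[of _ _ _ _ "(+)"] sum.cong) auto
      also have "(\<Sum>i=1..m. euler S \<alpha> i + euler S \<alpha> (i + m + 1)) = tz \<alpha>0 - 2 * int (coef \<alpha> (m + 1))"
        using tz ez unfolding tz_def sum_pairs[of "euler S \<alpha>"] by linarith
      finally show ?thesis unfolding B_def by linarith
    qed
    hence "A \<subseteq> {\<alpha>. Poly_Mapping.keys \<alpha> \<subseteq> {1..?n} \<and> (\<forall>i. coef \<alpha> i \<le> nat B)}"
      by (auto simp: A_def)
    thus ?thesis by (rule finite_subset) (intro finite_bounded_exps finite_atLeastAtMost)
  qed simp
  moreover have "weight_space m (piM ?n c S (\<lambda>_. 0)) (polys ?n) \<mu> \<subseteq> mpol.span (mon ` A)"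
  proof
    fix f assume f: "f \<in> weight_space m (piM ?n c S (\<lambda>_. 0)) (polys ?n) \<mu>"
    show "f \<in> mpol.span (mon ` A)"
    proof (rule poly_in_subspace[OF mpol.subspace_span])
      fix \<alpha> assume "\<alpha> \<in> Poly_Mapping.keys f"
      hence "\<alpha> \<in> A" using f unfolding weight_space_iff by (auto simp: A_def polys_def in_keys_iff)
      thus "mon \<alpha> \<in> mpol.span (mon ` A)" by (intro mpol.span_base imageI)
    qed
  qed
  ultimately show ?thesis unfolding fin_dim_iff by blast
qed

lemma polys_nonzero: "polys n \<noteq> {0 :: ('a::field_char_0) mpol}"
proof -
  have "(1 :: 'a mpol) \<in> polys n" by (simp add: polys_def)
  moreover have "(1 :: 'a mpol) \<noteq> 0" by simp
  ultimately show ?thesis by (metis singletonD)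
qed

theorem theorem2:
  fixes c :: "'a::field_char_0" and a :: "nat \<Rightarrow> 'a" and m n :: nat and S :: "nat set"
  assumes hm: "m \<ge> 1"
    and hn: "n = 2 * m + 1"
    and hS: "S \<subseteq> {1..n}"
    and hS1: "m + 1 \<notin> S"
    and hS2: "\<forall>i\<in>{1..m}. \<not> (i \<in> S \<and> i + m + 1 \<in> S)"
  shows
   "((\<forall>k::nat. c \<noteq> - of_nat k) \<longrightarrow>
        irreducible_mod (piM n c {} (\<lambda>_. 0)) (sp m) (polys n))
    \<and> ((\<exists>k::nat. c = - of_nat k) \<longrightarrow>
        comp_series_length2 (piM n c {} (\<lambda>_. 0)) (sp m) (polys n))
    \<and> ((S \<noteq> {} \<and> c \<notin> \<int>) \<longrightarrow>
        irreducible_mod (piM n c S (\<lambda>_. 0)) (sp m) (polys n))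
    \<and> (((\<exists>i\<in>{1..n}. a i \<noteq> 0) \<and> a (m + 1) = 0
         \<and> (S \<inter> {m+2..2*m+1} \<noteq> {} \<longrightarrow> (\<exists>i0\<ge>1. m + 1 + i0 \<in> S \<and> a i0 \<noteq> 0))
         \<and> (S \<inter> {1..m+1} \<noteq> {} \<longrightarrow> (\<exists>j0\<in>S \<inter> {1..m+1}. a (m + 1 + j0) \<noteq> 0)))
       \<longrightarrow> irreducible_mod (piM n c S a) (sp m) (polys n))
    \<and> (weight_module m (piM n c S (\<lambda>_. 0)) (polys n)
       \<and> \<not> fin_dim (polys n :: 'a mpol set)
       \<and> (\<forall>\<mu>. fin_dim (weight_space m (piM n c S (\<lambda>_. 0)) (polys n) \<mu>)))"
proof (intro conjI impI)
  assume c: "\<forall>k::nat. c \<noteq> - of_nat k"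
  have "W = {0} \<or> W = polys n" if "submodule (piM n c {} (\<lambda>_. 0)) (sp m) (polys n) W" for W
  proof -
    interpret sp_submodule_std m n c W using hm hn that by unfold_locales auto
    show ?thesis using irreducible c by blast
  qed
  thus "irreducible_mod (piM n c {} (\<lambda>_. 0)) (sp m) (polys n)"
    by (simp add: irreducible_mod_def polys_nonzero)
next
  assume "\<exists>k::nat. c = - of_nat k"
  thus "comp_series_length2 (piM n c {} (\<lambda>_. 0)) (sp m) (polys n)"
    using comp_series[OF hm hn] by blast
next
  assume "S \<noteq> {} \<and> c \<notin> \<int>"
  hence c: "c \<notin> \<int>" by blast
  have "W = {0} \<or> W = polys n" if "submodule (piM n c S (\<lambda>_. 0)) (sp m) (polys n) W" for W
  proof -
    interpret sp_submodule_weight m n c S W using hm hn hS1 that by unfold_locales auto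
    show ?thesis using irreducible c by blast
  qed
  thus "irreducible_mod (piM n c S (\<lambda>_. 0)) (sp m) (polys n)"
    by (simp add: irreducible_mod_def polys_nonzero)
next
  assume a: "(\<exists>i\<in>{1..n}. a i \<noteq> 0) \<and> a (m + 1) = 0
      \<and> (S \<inter> {m+2..2*m+1} \<noteq> {} \<longrightarrow> (\<exists>i0\<ge>1. m + 1 + i0 \<in> S \<and> a i0 \<noteq> 0))
      \<and> (S \<inter> {1..m+1} \<noteq> {} \<longrightarrow> (\<exists>j0\<in>S \<inter> {1..m+1}. a (m + 1 + j0) \<noteq> 0))"
  have dS: "dual m u \<notin> S" if "u \<in> S" for u
  proof
    assume d: "dual m u \<in> S"
    show False
    proof (cases "u \<le> m + 1")
      case True
      moreover have "u \<noteq> m + 1" using that hS1 by blast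
      ultimately have "u \<le> m" "u \<ge> 1" using that hS by auto
      thus False using hS2 d that by (auto simp: dual_def)
    next
      case False
      define i where "i = u - (m + 1)"
      have "i \<in> {1..m}" "u = i + m + 1" using False that hS hn by (auto simp: i_def)
      thus False using hS2 d that by (auto simp: dual_def)
    qed
  qed
  \<comment> \<open>For empty S any nonzero entry of a serves, its index differing from m + 1 where
    a vanishes. Otherwise v is the partner of an index of S and hence lies outside S.\<close>
  obtain v where v: "v \<in> {1..n} - {m + 1}" "v \<notin> S" "a v \<noteq> 0"
  proof (cases "S = {}")
    case True
    thus ?thesis using that a by fastforce
  next
    case False
    have "S \<inter> {m+2..2*m+1} \<noteq> {} \<or> S \<inter> {1..m+1} \<noteq> {}"
    proof -
      obtain s where s: "s \<in> S" using False by blast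
      have "s \<in> {m+2..2*m+1} \<or> s \<in> {1..m+1}" using subsetD[OF hS s] hn by auto
      thus ?thesis using s by blast
    qed
    thus ?thesis
    proof
      assume "S \<inter> {m+2..2*m+1} \<noteq> {}"
      then obtain i where i: "i \<ge> 1" "m + 1 + i \<in> S" "a i \<noteq> 0" using a by blast
      have im: "i \<le> m" using i(2) hS hn by auto
      have "i \<notin> S" using hS2 i im by (auto simp: add_ac)
      thus ?thesis using that[of i] i im hn by auto
    next
      assume "S \<inter> {1..m+1} \<noteq> {}"
      then obtain j where j: "j \<in> S" "j \<in> {1..m+1}" "a (m + 1 + j) \<noteq> 0" using a by blast
      have "j \<noteq> m + 1" using j(1) hS1 by blast
      hence jm: "j \<le> m" using j(2) by auto
      have "m + 1 + j \<notin> S" using hS2 j jm by (auto simp: add_ac)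
      thus ?thesis using that[of "m + 1 + j"] j jm hn by auto
    qed
  qed
  have "W = {0} \<or> W = polys n" if "submodule (piM n c S a) (sp m) (polys n) W" for W
  proof -
    interpret sp_submodule_twisted m n c S a W v
      using hm hn hS1 a v dS that by unfold_locales auto
    show ?thesis using irreducible by blast
  qed
  thus "irreducible_mod (piM n c S a) (sp m) (polys n)"
    by (simp add: irreducible_mod_def polys_nonzero)
next
  show "weight_module m (piM n c S (\<lambda>_. 0)) (polys n)"
    unfolding hn by (rule weight_module_polys)
  show "\<not> fin_dim (polys n :: 'a mpol set)"
    using polys_not_fin_dim[of n, where 'a = 'a] hn by simp
  show "\<forall>\<mu>. fin_dim (weight_space m (piM n c S (\<lambda>_. 0)) (polys n) \<mu>)"
    unfolding hn using weight_space_fin_dim hS1 hS2 by blast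
qed

end
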